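(* In the setting described in the context, let $G=T^n\langle\theta\rangle$, let $E$ be a minimal normal subgroup of $F^n{:}\langle\theta\rangle$ such that (1) $E\cong\mathbb{Z}_p^{2f}$, (2) $\langle\theta\rangle$ acts transitively on $E\setminus\{1\}$ by conjugation, and (3) $\pi_i(E)=F$ for all $i$ and $\ker(\pi_i)\cap E\ne\ker(\pi_j)\cap E$ for $1\leqslant i<j\leqslant n$; and let $H=E{:}\langle\theta\rangle$. Suppose that $N_X(\langle b,c\rangle)$ contains an involution $o$ of $T$ such that $X=\langle F,b,c,o\rangle$. Let $\mathbf{o}=(o,o,\ldots,o)\in X^n$ and $\Gamma(X)=\mathrm{Cos}(G,H,\mathbf{o})$. Then $\Gamma(X)$ is connected, $(G,2)$-arc-transitive and of valency $q^2$.
   Context: Setting: (C1) $q=p^f$ for a prime $p$ and integer $f\geqslant1$, and $n:=q+1=2^sr^t>3$ where $t\geqslant0$, $r$ is an odd prime, and either $s\geqslant2$ or $q$ is even. (C2) $X$ is an almost simple group with socle $T$, $|X:T|\leqslant2$, and $X$ has a subgroup $R\cong\mathrm{AGL}_1(q)$, written $R=F{:}(\langle b\rangle\times\langle c\rangle)$ with $F\cong\mathbb{Z}_p^f$, $b$ of order $\frac{q-1}{\gcd(2,q-1)}$ and $c$ of order $\gcd(2,q-1)$. (C3) $\tau=(1,2,\ldots,n)\in S_n$ and $W=X\wr\langle\tau\rangle=X^n{:}\langle\tau\rangle$ with $\tau^{-1}(x_1,\ldots,x_n)\tau=(x_n,x_1,\ldots,x_{n-1})$. (C4) $\pi_i:(x_1,\ldots,x_n)\mapsto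 x_i$ are the projections $X^n\to X$. Put $\mathbf{d}_0=(bc,b,bc,\ldots,bc)\in R^n$ (second coordinate $b$, all others $bc$) and $\theta=\mathbf{d}_0\tau\in W$. For a finite group $G$, a core-free subgroup $H$ and a $2$-element $g\in G\setminus H$ with $g^2\in H$, the coset graph $\mathrm{Cos}(G,H,g)$ has vertex set the set $[G:H]$ of right cosets of $H$, with $Hx$ adjacent to $Hy$ iff $yx^{-1}\in HgH$; $G$ acts on it by right multiplication. $(G,2)$-arc-transitive means $G$ is transitive on triples $(\alpha,\beta,\gamma)$ of distinct vertices with $\alpha\sim\beta\sim\gamma$. *)

theory Defs
  imports "HOL-Algebra.Algebra" "HOL-Library.FuncSet"
begin

definition minimal_normal :: "('a, 'b) monoid_scheme \<Rightarrow> 'a set \<Rightarrow> bool" where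
  "minimal_normal G N \<longleftrightarrow> N \<lhd> G \<and> N \<noteq> {\<one>\<^bsub>G\<^esub>} \<and>
     (\<forall>M. M \<lhd> G \<and> M \<subseteq> N \<longrightarrow> M = {\<one>\<^bsub>G\<^esub>} \<or> M = N)"

definition socle :: "('a, 'b) monoid_scheme \<Rightarrow> 'a set" where
  "socle G = generate G (\<Union>{N. minimal_normal G N})"

definition almost_simple_with_socle :: "('a, 'b) monoid_scheme \<Rightarrow> 'a set \<Rightarrow> bool" where
  "almost_simple_with_socle Y T \<longleftrightarrow> group Y \<and> finite (carrier Y) \<and> socle Y = T \<and>
     simple_group (Y\<lparr>carrier := T\<rparr>) \<and> \<not> comm_group (Y\<lparr>carrier := T\<rparr>)"

definition elem_ab :: "nat \<Rightarrow> nat \<Rightarrow> (nat \<Rightarrow> int) monoid" where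
  "elem_ab p k = product_group {..<k} (\<lambda>_. integer_mod_group p)"

text \<open>AGL_1 over a field K: the affine maps x |-> a x + b (a nonzero), composed left to right.\<close>
definition AGL1 :: "('k, 'c) ring_scheme \<Rightarrow> ('k \<times> 'k) monoid" where
  "AGL1 K = \<lparr>carrier = (carrier K - {\<zero>\<^bsub>K\<^esub>}) \<times> carrier K,
     monoid.mult = (\<lambda>(a, b) (c, d). (c \<otimes>\<^bsub>K\<^esub> a, c \<otimes>\<^bsub>K\<^esub> b \<oplus>\<^bsub>K\<^esub> d)),
     one = (\<one>\<^bsub>K\<^esub>, \<zero>\<^bsub>K\<^esub>)\<rparr>"

text \<open>Elements (x, k) stand for (x_0,...,x_{n-1}) tau^k, coordinates indexed 0..n-1
 (coordinate i here is coordinate i+1 of the paper). Since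
 tau^{-1} (x_1,...,x_n) tau = (x_n,x_1,...,x_{n-1}), we get
 tau^k x tau^{-k} = (x_{i+k mod n})_i, hence the multiplication below.\<close>
definition wreath :: "('a, 'b) monoid_scheme \<Rightarrow> nat \<Rightarrow> ((nat \<Rightarrow> 'a) \<times> nat) monoid" where
  "wreath Y n = \<lparr>carrier = ({0..<n} \<rightarrow>\<^sub>E carrier Y) \<times> {0..<n},
     monoid.mult = (\<lambda>(x, k) (y, l). ((\<lambda>i\<in>{0..<n}. x i \<otimes>\<^bsub>Y\<^esub> y ((i + k) mod n)), (k + l) mod n)),
     one = ((\<lambda>i\<in>{0..<n}. \<one>\<^bsub>Y\<^esub>), 0)\<rparr>"

definition wr_tau :: "('a, 'b) monoid_scheme \<Rightarrow> nat \<Rightarrow> (nat \<Rightarrow> 'a) \<times> nat" where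
  "wr_tau Y n = ((\<lambda>i\<in>{0..<n}. \<one>\<^bsub>Y\<^esub>), 1 mod n)"

definition base_pow :: "nat \<Rightarrow> 'a set \<Rightarrow> ((nat \<Rightarrow> 'a) \<times> nat) set" where
  "base_pow n S = ({0..<n} \<rightarrow>\<^sub>E S) \<times> {0}"

definition proj :: "nat \<Rightarrow> (nat \<Rightarrow> 'a) \<times> nat \<Rightarrow> 'a" where
  "proj i w = fst w i"

definition proj_ker :: "('a, 'b) monoid_scheme \<Rightarrow> nat \<Rightarrow> nat \<Rightarrow> ((nat \<Rightarrow> 'a) \<times> nat) set" where
  "proj_ker Y n i = {w \<in> base_pow n (carrier Y). proj i w = \<one>\<^bsub>Y\<^esub>}"

definition cos_vertices :: "('g, 'b) monoid_scheme \<Rightarrow> 'g set \<Rightarrow> 'g set \<Rightarrow> 'g set set" where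
  "cos_vertices W G H = rcosets\<^bsub>W\<lparr>carrier := G\<rparr>\<^esub> H"

definition cos_adj :: "('g, 'b) monoid_scheme \<Rightarrow> 'g set \<Rightarrow> 'g set \<Rightarrow> 'g \<Rightarrow> 'g set \<Rightarrow> 'g set \<Rightarrow> bool" where
  "cos_adj W G H g A B \<longleftrightarrow> (\<exists>x\<in>G. \<exists>y\<in>G. A = H #>\<^bsub>W\<^esub> x \<and> B = H #>\<^bsub>W\<^esub> y \<and>
      y \<otimes>\<^bsub>W\<^esub> inv\<^bsub>W\<^esub> x \<in> H <#>\<^bsub>W\<^esub> {g} <#>\<^bsub>W\<^esub> H)"

definition graph_connected :: "'v set \<Rightarrow> ('v \<Rightarrow> 'v \<Rightarrow> bool) \<Rightarrow> bool" where
  "graph_connected V E \<longleftrightarrow> (\<forall>u\<in>V. \<forall>v\<in>V. (\<lambda>a b. a \<in> V \<and> b \<in> V \<and> E a b)\<^sup>*\<^sup>* u v)"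

definition graph_valency :: "'v set \<Rightarrow> ('v \<Rightarrow> 'v \<Rightarrow> bool) \<Rightarrow> nat \<Rightarrow> bool" where
  "graph_valency V E k \<longleftrightarrow> (\<forall>u\<in>V. card {v \<in> V. E u v} = k)"

definition two_arcs :: "'v set \<Rightarrow> ('v \<Rightarrow> 'v \<Rightarrow> bool) \<Rightarrow> ('v \<times> 'v \<times> 'v) set" where
  "two_arcs V E = {(a, b, c). a \<in> V \<and> b \<in> V \<and> c \<in> V \<and> a \<noteq> b \<and> b \<noteq> c \<and> a \<noteq> c \<and> E a b \<and> E b c}"

definition cos_two_arc_transitive :: "('g, 'b) monoid_scheme \<Rightarrow> 'g set \<Rightarrow> 'g set \<Rightarrow> 'g \<Rightarrow> bool" where
  "cos_two_arc_transitive W G H g \<longleftrightarrow>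
     (let V = cos_vertices W G H; E = cos_adj W G H g in
      \<forall>s\<in>two_arcs V E. \<forall>t\<in>two_arcs V E. \<exists>z\<in>G.
        (case s of (a, b, c) \<Rightarrow> (a #>\<^bsub>W\<^esub> z, b #>\<^bsub>W\<^esub> z, c #>\<^bsub>W\<^esub> z)) = t)"

end

theory Submission
  imports Defs
begin

text \<open>Put \<open>D = \<langle>\<theta>\<rangle>\<close> and let \<open>g\<close> be the diagonal involution. The power \<open>\<theta>\<^sup>n\<close> is the diagonal
  element of \<open>z = b\<^sup>2 c\<close>, which generates \<open>\<langle>b, c\<rangle>\<close>; hence \<open>\<theta>\<close> has order dividing \<open>q\<^sup>2 - 1\<close>,
  \<open>D\<close> meets \<open>E\<close> trivially and \<open>g\<close> normalises \<open>D\<close>. Since \<open>D\<close> is transitive on \<open>E - {1}\<close>, either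
  \<open>H \<inter> H\<^sup>g = D\<close> or \<open>g\<close> normalises \<open>H\<close>. In the latter case \<open>g\<close> normalises \<open>E\<close>, which is
  characteristic in \<open>H\<close>, so \<open>F\<close> would be an abelian normal subgroup of the almost simple group.
  In the former case the neighbours of a vertex correspond to the elements of \<open>E\<close>, and the
  transitivity of \<open>D\<close> on \<open>E - {1}\<close> gives transitivity on 2-arcs.

  For connectedness, \<open>\<langle>H, g\<rangle> \<inter> X\<^sup>n\<close> projects onto \<open>X\<close> in each coordinate, and \<open>E\<close> separates
  any two coordinates because its \<open>n\<close> kernels are distinct and of equal order, so a
  Goursat argument shows that \<open>\<langle>H, g\<rangle>\<close> contains \<open>T\<^sup>n\<close>. Finally \<open>E \<subseteq> T\<^sup>n\<close>: since \<open>q\<^sup>2 - 1 > n\<close>,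
  \<open>\<theta>\<^sup>n\<close> does not centralise \<open>E\<close>, and the commutators \<open>[e, \<theta>\<^sup>n]\<close> lie in \<open>T\<^sup>n\<close> because
  \<open>X / T\<close> is abelian.\<close>

section \<open>Coset graphs with a split vertex stabiliser\<close>

context group begin

lemma inv_cancel_left [simp]:
  "x \<in> carrier G \<Longrightarrow> y \<in> carrier G \<Longrightarrow> inv x \<otimes> (x \<otimes> y) = y"
  "x \<in> carrier G \<Longrightarrow> y \<in> carrier G \<Longrightarrow> x \<otimes> (inv x \<otimes> y) = y"
  by (simp_all flip: m_assoc)

lemma rcos_eqI:
  assumes "subgroup H G" "h \<in> H" "x \<in> carrier G"
  shows "H #> (h \<otimes> x) = H #> x"
  using assms by (metis coset_join2 coset_mult_assoc subgroup.mem_carrier subgroup.subset)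

lemma rcos_eqD:
  assumes "subgroup H G" "H #> x = H #> y" "x \<in> carrier G" "y \<in> carrier G"
  shows "\<exists>h\<in>H. x = h \<otimes> y"
  using rcos_self[OF assms(3,1)] assms(2) by (auto simp: r_coset_def)

lemma set_mult_subgroupI:
  assumes A: "subgroup A G" and B: "subgroup B G"
    and n: "\<And>a b. a \<in> A \<Longrightarrow> b \<in> B \<Longrightarrow> b \<otimes> a \<otimes> inv b \<in> A"
  shows "subgroup (A <#> B) G"
proof
  note c = subgroup.mem_carrier[OF A] subgroup.mem_carrier[OF B]
  show "A <#> B \<subseteq> carrier G" by (auto simp: set_mult_def c)
  show "\<one> \<in> A <#> B"
    using subgroup.one_closed[OF A] subgroup.one_closed[OF B] by (force simp: set_mult_def)
  show "x \<otimes> y \<in> A <#> B" if x: "x \<in> A <#> B" and y: "y \<in> A <#> B" for x y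
  proof -
    from x y obtain a d a' d' where *: "a \<in> A" "d \<in> B" "x = a \<otimes> d" "a' \<in> A" "d' \<in> B" "y = a' \<otimes> d'"
      by (auto simp: set_mult_def)
    then have "x \<otimes> y = (a \<otimes> (d \<otimes> a' \<otimes> inv d)) \<otimes> (d \<otimes> d')" by (simp add: c m_assoc)
    moreover have "a \<otimes> (d \<otimes> a' \<otimes> inv d) \<in> A" "d \<otimes> d' \<in> B"
      using * n A B by (auto simp: subgroup.m_closed)
    ultimately show ?thesis by (auto simp: set_mult_def)
  qed
  show "inv x \<in> A <#> B" if x: "x \<in> A <#> B" for x
  proof -
    from x obtain a d where *: "a \<in> A" "d \<in> B" "x = a \<otimes> d"
      by (auto simp: set_mult_def)
    then have "inv x = (inv d \<otimes> inv a \<otimes> inv (inv d)) \<otimes> inv d" by (simp add: c m_assoc inv_mult_group)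
    moreover have "inv d \<otimes> inv a \<otimes> inv (inv d) \<in> A" "inv d \<in> B"
      using * n A B by (auto simp: subgroup.m_inv_closed)
    ultimately show ?thesis by (auto simp: set_mult_def)
  qed
qed

end

text \<open>By \<open>gD\<close> and \<open>gE\<close>, \<open>H\<close> meets its conjugate under
  \<open>g\<close> exactly in \<open>D\<close>: for \<open>e\<close> in \<open>E\<close> and
  \<open>d\<close> in \<open>D\<close>, the conjugate of \<open>e d\<close> lies in \<open>H\<close>
  iff that of \<open>e\<close> does. The graph is studied from these conditions alone.\<close>

locale split_coset_graph = group W for W (structure) +
  fixes G E D H g
  assumes G: "subgroup G W" and E: "subgroup E W" and D: "subgroup D W"
    and EG: "E \<subseteq> G" and DG: "D \<subseteq> G" and gG: "g \<in> G"
    and H_def: "H = E <#> D"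
    and D_norm: "\<And>d e. d \<in> D \<Longrightarrow> e \<in> E \<Longrightarrow> inv d \<otimes> e \<otimes> d \<in> E"
    and D_trans: "\<And>e e'. e \<in> E - {\<one>} \<Longrightarrow> e' \<in> E - {\<one>} \<Longrightarrow> \<exists>d\<in>D. inv d \<otimes> e \<otimes> d = e'"
    and gg: "g \<otimes> g = \<one>"
    and gD: "\<And>d. d \<in> D \<Longrightarrow> g \<otimes> d \<otimes> g \<in> D"
    and gE: "\<And>e. e \<in> E - {\<one>} \<Longrightarrow> g \<otimes> e \<otimes> g \<notin> H"
begin

abbreviation "V \<equiv> cos_vertices W G H"
abbreviation "adj \<equiv> cos_adj W G H g"

lemma G_carrier: "x \<in> G \<Longrightarrow> x \<in> carrier W"
  using subgroup.mem_carrier[OF G] .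

lemma E_carrier: "x \<in> E \<Longrightarrow> x \<in> carrier W"
  using subgroup.mem_carrier[OF E] .

lemma D_carrier: "x \<in> D \<Longrightarrow> x \<in> carrier W"
  using subgroup.mem_carrier[OF D] .

lemma g_carrier: "g \<in> carrier W"
  using gG G_carrier by simp

lemma inv_g: "inv g = g"
  using gg g_carrier by (simp add: inv_equality)

lemma g_cancel: "x \<in> carrier W \<Longrightarrow> g \<otimes> (g \<otimes> x) = x"
  using gg g_carrier by (simp flip: m_assoc)

lemma subgroup_H: "subgroup H W"
  unfolding H_def
proof (rule set_mult_subgroupI[OF E D])
  show "d \<otimes> e \<otimes> inv d \<in> E" if "e \<in> E" "d \<in> D" for e d
    using D_norm[of "inv d" e] that D by (simp add: subgroup.m_inv_closed D_carrier)
qed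

lemma H_carrier: "x \<in> H \<Longrightarrow> x \<in> carrier W"
  using subgroup.mem_carrier[OF subgroup_H] .

lemma EH: "E \<subseteq> H"
  using subgroup.one_closed[OF D] E_carrier unfolding H_def set_mult_def by force

lemma DH: "D \<subseteq> H"
  using subgroup.one_closed[OF E] D_carrier unfolding H_def set_mult_def by force

lemma HG: "H \<subseteq> G"
  using EG DG subgroup.m_closed[OF G] unfolding H_def set_mult_def by blast

text \<open>The order \<open>D E\<close> brings the factor from \<open>D\<close> next to
  \<open>g\<close> in \<open>H g H\<close>.\<close>

lemma H_factor:
  assumes "h \<in> H" shows "\<exists>d\<in>D. \<exists>e\<in>E. h = d \<otimes> e"
proof -
  from assms obtain d e where *: "d \<in> D" "e \<in> E" "h = e \<otimes> d" by (auto simp: H_def set_mult_def)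
  then have "h = d \<otimes> (inv d \<otimes> e \<otimes> d)" by (simp add: D_carrier E_carrier m_assoc)
  with * D_norm show ?thesis by blast
qed

lemma V_iff: "A \<in> V \<longleftrightarrow> (\<exists>x\<in>G. A = H #> x)"
  by (simp add: cos_vertices_def RCOSETS_def r_coset_def)

lemma double_coset_iff: "z \<in> H <#> {g} <#> H \<longleftrightarrow> (\<exists>h\<in>H. \<exists>k\<in>H. z = h \<otimes> g \<otimes> k)"
  by (auto simp: set_mult_def)

text \<open>Moved to the left of \<open>g\<close>, the element \<open>d\<close> becomes
  \<open>g d g\<close>, which is in \<open>D\<close> and is absorbed by \<open>H\<close>.\<close>

lemma rcos_g_D:
  assumes "d \<in> D" "x \<in> carrier W" shows "H #> (g \<otimes> (d \<otimes> x)) = H #> (g \<otimes> x)"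
proof -
  have "g \<otimes> (d \<otimes> x) = (g \<otimes> d \<otimes> g) \<otimes> (g \<otimes> x)"
    using assms by (simp add: D_carrier g_carrier m_assoc g_cancel)
  then show ?thesis
    using rcos_eqI[OF subgroup_H, of "g \<otimes> d \<otimes> g" "g \<otimes> x"] gD[OF assms(1)] DH assms(2) g_carrier by auto
qed

text \<open>The point stabiliser acts on neighbours through \<open>E\<close>, since \<open>H g H = H g E\<close>.\<close>

lemma adj_iff:
  assumes x: "x \<in> G"
  shows "adj (H #> x) B \<longleftrightarrow> (\<exists>e\<in>E. B = H #> (g \<otimes> (e \<otimes> x)))"
proof
  assume "adj (H #> x) B"
  then obtain x' y h k where *: "x' \<in> G" "y \<in> G" "H #> x = H #> x'" "B = H #> y" "h \<in> H" "k \<in> H"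
    "y \<otimes> inv x' = h \<otimes> g \<otimes> k"
    unfolding cos_adj_def double_coset_iff by blast
  obtain m where m: "m \<in> H" "x' = m \<otimes> x"
    using rcos_eqD[OF subgroup_H] * x G_carrier by metis
  have "k \<otimes> m \<in> H" using * m subgroup.m_closed[OF subgroup_H] by blast
  then obtain d e where de: "d \<in> D" "e \<in> E" "k \<otimes> m = d \<otimes> e" using H_factor by blast
  have "y = h \<otimes> g \<otimes> k \<otimes> x'"
    using * G_carrier by (metis inv_closed inv_solve_right m_closed)
  also have "\<dots> = h \<otimes> (g \<otimes> ((k \<otimes> m) \<otimes> x))"
    using m * x by (simp add: H_carrier G_carrier g_carrier m_assoc)
  also have "\<dots> = h \<otimes> (g \<otimes> (d \<otimes> (e \<otimes> x)))"
    using de x by (simp add: D_carrier E_carrier G_carrier g_carrier m_assoc)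
  finally have "B = H #> (g \<otimes> (e \<otimes> x))"
    using * rcos_eqI[OF subgroup_H, of h] rcos_g_D de x
    by (simp add: D_carrier E_carrier G_carrier g_carrier)
  then show "\<exists>e\<in>E. B = H #> (g \<otimes> (e \<otimes> x))" using de by blast
next
  assume "\<exists>e\<in>E. B = H #> (g \<otimes> (e \<otimes> x))"
  then obtain e where e: "e \<in> E" "B = H #> (g \<otimes> (e \<otimes> x))" by blast
  have "g \<otimes> (e \<otimes> x) \<otimes> inv x = \<one> \<otimes> g \<otimes> e"
    using e x by (simp add: E_carrier G_carrier g_carrier m_assoc)
  moreover have "g \<otimes> (e \<otimes> x) \<in> G" using e x EG gG subgroup.m_closed[OF G] by blast
  ultimately show "adj (H #> x) B"
    unfolding cos_adj_def double_coset_iff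
    using e x EH subgroup.one_closed[OF subgroup_H] by blast
qed

text \<open>As \<open>g\<close> is its own inverse, the double coset \<open>H g H\<close> is closed
  under inversion.\<close>

lemma adj_sym:
  assumes "adj A B" shows "adj B A"
proof -
  obtain x y h k where *: "x \<in> G" "y \<in> G" "A = H #> x" "B = H #> y" "h \<in> H" "k \<in> H"
    "y \<otimes> inv x = h \<otimes> g \<otimes> k"
    using assms unfolding cos_adj_def double_coset_iff by blast
  have "x \<otimes> inv y = inv (y \<otimes> inv x)" using *(1,2) by (simp add: G_carrier inv_mult_group)
  also have "\<dots> = inv k \<otimes> g \<otimes> inv h"
    using * by (simp add: H_carrier g_carrier inv_mult_group inv_g m_assoc)
  finally show ?thesis
    unfolding cos_adj_def double_coset_iff
    using * subgroup.m_inv_closed[OF subgroup_H] by blast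
qed

text \<open>Equal cosets would put the \<open>g\<close>-conjugate of the non-identity element
  \<open>e inv e'\<close> into \<open>H\<close>, against \<open>gE\<close>.\<close>

lemma neighbour_inj:
  assumes e: "e \<in> E" "e' \<in> E" and x: "x \<in> G"
    and eq: "H #> (g \<otimes> (e \<otimes> x)) = H #> (g \<otimes> (e' \<otimes> x))"
  shows "e = e'"
proof (rule ccontr)
  assume ne: "e \<noteq> e'"
  note c = E_carrier G_carrier g_carrier H_carrier
  obtain h where h: "h \<in> H" "g \<otimes> (e \<otimes> x) = h \<otimes> (g \<otimes> (e' \<otimes> x))"
    using rcos_eqD[OF subgroup_H eq] e x by (auto simp: c)
  have "g \<otimes> e \<otimes> x = h \<otimes> g \<otimes> e' \<otimes> x" using h e x by (simp add: c m_assoc)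
  then have "g \<otimes> e = h \<otimes> g \<otimes> e'" using h e x by (simp add: c)
  then have "g \<otimes> (e \<otimes> inv e') \<otimes> g = h"
    using h e gg by (simp add: c flip: m_assoc) (simp add: c m_assoc)
  moreover have "e \<otimes> inv e' \<in> E - {\<one>}"
    using e ne E c(1)
    by (metis DiffI inv_equality inv_inv inv_closed singletonD subgroup.m_closed subgroup.m_inv_closed)
  ultimately show False using gE h by blast
qed

lemma valency: "graph_valency V adj (card E)"
  unfolding graph_valency_def
proof
  fix A assume "A \<in> V"
  then obtain x where x: "x \<in> G" "A = H #> x" using V_iff by blast
  have "{B \<in> V. adj A B} = (\<lambda>e. H #> (g \<otimes> (e \<otimes> x))) ` E"
    using x EG gG subgroup.m_closed[OF G] by (auto simp: adj_iff V_iff intro!: bexI)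
  moreover have "inj_on (\<lambda>e. H #> (g \<otimes> (e \<otimes> x))) E"
    using neighbour_inj x by (auto intro: inj_onI)
  ultimately show "card {B \<in> V. adj A B} = card E" by (simp add: card_image)
qed

text \<open>Arcs are described from the middle vertex, whose two neighbours carry distinct labels
  from \<open>E\<close>; symmetry of adjacency turns the first edge round.\<close>

lemma two_arcsE:
  assumes "(A, B, C) \<in> two_arcs V adj"
  obtains x e e' where "x \<in> G" "e \<in> E" "e' \<in> E" "e \<noteq> e'"
    "A = H #> (g \<otimes> (e \<otimes> x))" "B = H #> x" "C = H #> (g \<otimes> (e' \<otimes> x))"
proof -
  from assms have *: "B \<in> V" "A \<noteq> C" "adj B A" "adj B C" by (auto simp: two_arcs_def adj_sym)
  then obtain x where x: "x \<in> G" "B = H #> x" using V_iff by blast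
  with * show thesis using that by (auto simp: adj_iff)
qed

lemma two_arc_transitive: "cos_two_arc_transitive W G H g"
  unfolding cos_two_arc_transitive_def Let_def
proof (intro ballI)
  fix s t assume st: "s \<in> two_arcs V adj" "t \<in> two_arcs V adj"
  obtain A B C A' B' C' where eq: "s = (A, B, C)" "t = (A', B', C')" by (metis prod_cases3)
  note c = E_carrier G_carrier g_carrier H_carrier D_carrier
  obtain x e1 e2 where x: "x \<in> G" "e1 \<in> E" "e2 \<in> E" "e1 \<noteq> e2"
    "A = H #> (g \<otimes> (e1 \<otimes> x))" "B = H #> x" "C = H #> (g \<otimes> (e2 \<otimes> x))"
    using two_arcsE st(1) unfolding eq .
  obtain y f1 f2 where y: "y \<in> G" "f1 \<in> E" "f2 \<in> E" "f1 \<noteq> f2"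
    "A' = H #> (g \<otimes> (f1 \<otimes> y))" "B' = H #> y" "C' = H #> (g \<otimes> (f2 \<otimes> y))"
    using two_arcsE st(2) unfolding eq .
  have E1: "a \<otimes> inv b \<in> E - {\<one>}" if "a \<in> E" "b \<in> E" "a \<noteq> b" for a b
    using that E c(1)
    by (metis DiffI inv_equality inv_inv inv_closed singletonD subgroup.m_closed subgroup.m_inv_closed)
  \<comment> \<open>Factors from \<open>E\<close> can be absorbed at the middle vertex, so it
    suffices to match the quotients of the two labels.\<close>
  obtain d where d: "d \<in> D" "inv d \<otimes> (e2 \<otimes> inv e1) \<otimes> d = f2 \<otimes> inv f1"
    using D_trans E1 x y by metis
  have d2: "e2 \<otimes> (inv e1 \<otimes> d) = d \<otimes> (f2 \<otimes> inv f1)"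
    using x d by (simp add: c m_assoc flip: d(2))
  \<comment> \<open>Chosen to make \<open>e1 x z = d f1 y\<close>; by \<open>d2\<close> also
    \<open>e2 x z = d f2 y\<close>, and \<open>d\<close> is absorbed behind \<open>g\<close>. On the
    middle vertex the factor \<open>inv e1 d f1\<close> lies in \<open>H\<close>.\<close>
  define z where "z = inv x \<otimes> (inv e1 \<otimes> (d \<otimes> (f1 \<otimes> y)))"
  have zG: "z \<in> G" unfolding z_def
    using x y d EG DG by (auto intro!: subgroup.m_closed[OF G] subgroup.m_inv_closed[OF G])
  have Hc: "H \<subseteq> carrier W" using subgroup.subset[OF subgroup_H] .
  have tr: "(H #> w) #> z = H #> (w \<otimes> z)" if "w \<in> carrier W" for w
    using that zG coset_mult_assoc Hc c(2) by blast
  have "A #> z = H #> (g \<otimes> (e1 \<otimes> x) \<otimes> z)" using x tr by (simp add: c)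
  also have "g \<otimes> (e1 \<otimes> x) \<otimes> z = g \<otimes> (d \<otimes> (f1 \<otimes> y))"
    unfolding z_def using x y d by (simp add: c m_assoc)
  finally have 1: "A #> z = A'" using rcos_g_D d y by (simp add: c)
  have "B #> z = H #> (x \<otimes> z)" using x tr by (simp add: c)
  also have "x \<otimes> z = (inv e1 \<otimes> d \<otimes> f1) \<otimes> y"
    unfolding z_def using x y d by (simp add: c m_assoc)
  also have "H #> \<dots> = H #> y"
  proof (rule rcos_eqI[OF subgroup_H])
    show "inv e1 \<otimes> d \<otimes> f1 \<in> H"
      using x y d EH DH by (auto intro!: subgroup.m_closed[OF subgroup_H] subgroup.m_inv_closed[OF subgroup_H])
  qed (use y c in auto)
  finally have 2: "B #> z = B'" using y by simp
  have "C #> z = H #> (g \<otimes> (e2 \<otimes> x) \<otimes> z)" using x tr by (simp add: c)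
  also have "g \<otimes> (e2 \<otimes> x) \<otimes> z = g \<otimes> ((e2 \<otimes> (inv e1 \<otimes> d)) \<otimes> (f1 \<otimes> y))"
    unfolding z_def using x y d by (simp add: c m_assoc)
  also have "\<dots> = g \<otimes> (d \<otimes> (f2 \<otimes> y))"
    unfolding d2 using x y d by (simp add: c m_assoc)
  finally have 3: "C #> z = C'" using rcos_g_D d y by (simp add: c)
  show "\<exists>z\<in>G. (case s of (a, b, c) \<Rightarrow> (a #> z, b #> z, c #> z)) = t"
    using zG 1 2 3 eq by auto
qed

text \<open>Multiplying a representative on the left by an element of \<open>H\<close> keeps the
  coset, and by \<open>g\<close> leads to a neighbour; a word in these generators is therefore a
  walk.\<close>

lemma connected:
  assumes gen: "G \<subseteq> generate W (insert g H)"
  shows "graph_connected V adj"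
proof -
  let ?R = "\<lambda>a b. a \<in> V \<and> b \<in> V \<and> adj a b"
  have adj_g: "?R (H #> x) (H #> (g \<otimes> x))" if "x \<in> G" for x
  proof -
    have "adj (H #> x) (H #> (g \<otimes> (\<one> \<otimes> x)))"
      using that subgroup.one_closed[OF E] by (auto simp: adj_iff)
    then show ?thesis
      using that gG subgroup.m_closed[OF G] by (auto simp: V_iff G_carrier)
  qed
  \<comment> \<open>The start \<open>x\<close> is quantified inside: a product \<open>h1 h2\<close>
    is walked by using the claim for \<open>h1\<close> at the start \<open>h2 x\<close>, which must
    lie in \<open>G\<close>.\<close>
  have step: "z \<in> G \<and> (\<forall>x\<in>G. ?R\<^sup>*\<^sup>* (H #> x) (H #> (z \<otimes> x)))"
    if "z \<in> generate W (insert g H)" for z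
    using that
  proof (induction rule: generate.induct)
    case one
    then show ?case using subgroup.one_closed[OF G] by (auto simp: G_carrier)
  next
    case (incl h)
    then show ?case
    proof
      assume "h = g"
      then show ?thesis using r_into_rtranclp[of ?R, OF adj_g] gG by blast
    next
      assume "h \<in> H"
      then have "H #> (h \<otimes> x) = H #> x" if "x \<in> G" for x
        using that rcos_eqI[OF subgroup_H] G_carrier by blast
      then show ?thesis using \<open>h \<in> H\<close> HG by auto
    qed
  next
    case (inv h)
    then show ?case
    proof
      assume "h = g"
      then have h: "inv h = g" using inv_g by simp
      show ?thesis unfolding h using r_into_rtranclp[of ?R, OF adj_g] gG by blast
    next
      assume "h \<in> H"
      then have "inv h \<in> H" using subgroup.m_inv_closed[OF subgroup_H] by blast
      then have "H #> (inv h \<otimes> x) = H #> x" if "x \<in> G" for x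
        using that rcos_eqI[OF subgroup_H] G_carrier by blast
      then show ?thesis using \<open>inv h \<in> H\<close> HG by auto
    qed
  next
    case (eng h1 h2)
    have "?R\<^sup>*\<^sup>* (H #> x) (H #> (h1 \<otimes> h2 \<otimes> x))" if x: "x \<in> G" for x
    proof -
      have "h2 \<otimes> x \<in> G" using x eng subgroup.m_closed[OF G] by blast
      then have "?R\<^sup>*\<^sup>* (H #> x) (H #> (h1 \<otimes> (h2 \<otimes> x)))"
        using eng.IH x rtranclp_trans[of ?R "H #> x" "H #> (h2 \<otimes> x)"] by blast
      then show ?thesis using eng x by (simp add: G_carrier m_assoc)
    qed
    then show ?case using eng subgroup.m_closed[OF G] by blast
  qed
  show ?thesis unfolding graph_connected_def
  proof (intro ballI)
    fix u v assume uv: "u \<in> V" "v \<in> V"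
    obtain x where x: "x \<in> G" "u = H #> x" using uv(1) unfolding V_iff ..
    obtain y where y: "y \<in> G" "v = H #> y" using uv(2) unfolding V_iff ..
    note xy = x(1) y(1) x(2) y(2)
    have "y \<otimes> inv x \<in> generate W (insert g H)"
      using x(1) y(1) gen subgroup.m_closed[OF G] subgroup.m_inv_closed[OF G] by blast
    then have "?R\<^sup>*\<^sup>* (H #> x) (H #> (y \<otimes> inv x \<otimes> x))"
      by (rule conjunct2[OF step, rule_format, OF _ xy(1)])
    moreover have "y \<otimes> inv x \<otimes> x = y" using xy by (simp add: G_carrier m_assoc)
    ultimately show "?R\<^sup>*\<^sup>* u v" unfolding xy(3,4) by (simp only:)
  qed
qed

end

section \<open>Almost simple groups\<close>

context group begin

lemma socle_normal: "socle G \<lhd> G"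
  unfolding socle_def
proof (rule normal_generateI)
  have N: "N \<lhd> G" if "minimal_normal G N" for N using that by (simp add: minimal_normal_def)
  show "\<Union>{N. minimal_normal G N} \<subseteq> carrier G"
    using N normal_imp_subgroup subgroup.subset by blast
  show "x \<otimes> h \<otimes> inv x \<in> \<Union>{N. minimal_normal G N}"
    if "h \<in> \<Union>{N. minimal_normal G N}" "x \<in> carrier G" for h x
  proof -
    from that obtain M where M: "minimal_normal G M" "h \<in> M" by blast
    then show ?thesis using normal.inv_op_closed2[OF N that(2)] by blast
  qed
qed

text \<open>By finiteness there is a nontrivial normal subgroup inside \<open>N\<close> of least
  cardinality.\<close>

lemma exists_minimal_normal:
  assumes "finite (carrier G)" "N \<lhd> G" "N \<noteq> {\<one>}"
  shows "\<exists>M. minimal_normal G M \<and> M \<subseteq> N"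
proof -
  define P where "P M \<longleftrightarrow> M \<lhd> G \<and> M \<noteq> {\<one>} \<and> M \<subseteq> N" for M
  have "P N" using assms by (simp add: P_def)
  then obtain M where M: "P M" "\<And>M'. P M' \<Longrightarrow> card M \<le> card M'"
    using ex_has_least_nat[of P N card] by blast
  have "finite M" using M(1) assms(1) normal_imp_subgroup subgroup.subset finite_subset
    unfolding P_def by metis
  then have "M' = {\<one>} \<or> M' = M" if "M' \<lhd> G" "M' \<subseteq> M" for M'
    using that M card_seteq[of M M'] unfolding P_def by blast
  then show ?thesis using M(1) unfolding P_def minimal_normal_def by blast
qed

text \<open>A minimal normal subgroup inside \<open>N\<close> lies in the socle \<open>T\<close>;
  simplicity makes it equal to \<open>T\<close>, which would then be abelian.\<close>

lemma almost_simple_abelian_normal_trivial: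
  assumes as: "almost_simple_with_socle G T"
    and N: "N \<lhd> G" and ab: "\<And>x y. x \<in> N \<Longrightarrow> y \<in> N \<Longrightarrow> x \<otimes> y = y \<otimes> x"
  shows "N = {\<one>}"
proof (rule ccontr)
  assume "N \<noteq> {\<one>}"
  moreover have "finite (carrier G)" and socle: "socle G = T"
    and simple: "simple_group (G\<lparr>carrier := T\<rparr>)" and nonab: "\<not> comm_group (G\<lparr>carrier := T\<rparr>)"
    using as by (auto simp: almost_simple_with_socle_def)
  ultimately obtain M where M: "minimal_normal G M" "M \<subseteq> N" using exists_minimal_normal N by blast
  then have MG: "M \<lhd> G" "M \<noteq> {\<one>}" by (auto simp: minimal_normal_def)
  have MT: "M \<subseteq> T" 
    unfolding socle[symmetric] socle_def using M(1) generate.incl[of _ "\<Union>{N. minimal_normal G N}" G] by auto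
  have T: "subgroup T G" using normal_imp_subgroup[OF socle_normal] socle by simp
  have "M \<lhd> G\<lparr>carrier := T\<rparr>"
    using normal_restrict_supergroup[OF T MG(1) MT] .
  then have "M = T"
    using simple_group.no_real_normal_subgroup[OF simple, of M] MG(2) by simp
  then have "comm_group (G\<lparr>carrier := T\<rparr>)"
    using group.group_comm_groupI[OF subgroup_imp_group[OF T]] ab M(2) by auto
  with nonab show False ..
qed

text \<open>Otherwise \<open>T\<close>, \<open>T x\<close> and \<open>T x^2\<close> would be three
  different cosets.\<close>

lemma square_mem_index_two:
  assumes T: "T \<lhd> G" and fin: "finite (carrier G)" and card: "card (rcosets T) \<le> 2"
    and x: "x \<in> carrier G"
  shows "x \<otimes> x \<in> T"
proof (rule ccontr)
  assume xx: "x \<otimes> x \<notin> T"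
  have sT: "subgroup T G" using T normal_imp_subgroup by blast
  have eqT: "y \<in> T" if "y \<in> carrier G" "T #> y = T" for y
    using that rcos_self[OF that(1) sT] by simp
  have x_not: "x \<notin> T" using xx subgroup.m_closed[OF sT] by auto
  have "T #> (x \<otimes> x) \<noteq> T #> x"
  proof
    assume "T #> (x \<otimes> x) = T #> x"
    then obtain t where "t \<in> T" "x \<otimes> x = t \<otimes> x" using rcos_eqD[OF sT _ _ x] x by auto
    then have "x = t" using x sT by (simp add: subgroup.mem_carrier)
    with x_not \<open>t \<in> T\<close> show False by simp
  qed
  moreover have "T #> (x \<otimes> x) \<noteq> T" "T #> x \<noteq> T"
    using eqT xx x_not x by auto
  ultimately have "card {T, T #> x, T #> (x \<otimes> x)} = 3" by (simp add: card_insert_if)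
  moreover have "{T, T #> x, T #> (x \<otimes> x)} \<subseteq> rcosets T"
    using x subgroup.subgroup_in_rcosets[OF sT group_axioms] rcosetsI[OF subgroup.subset[OF sT]]
    by simp
  moreover have "finite (rcosets T)" using fin by (simp add: RCOSETS_def)
  ultimately have "3 \<le> card (rcosets T)" by (metis card_mono)
  with card show False by simp
qed

text \<open>The commutator is a product of three squares: those of \<open>inv x\<close>, of
  \<open>x inv y\<close> and of \<open>y\<close>.\<close>

lemma commutator_mem_index_two:
  assumes "T \<lhd> G" "finite (carrier G)" "card (rcosets T) \<le> 2"
    and x: "x \<in> carrier G" and y: "y \<in> carrier G"
  shows "inv x \<otimes> inv y \<otimes> x \<otimes> y \<in> T"
proof -
  note sq = square_mem_index_two[OF assms(1-3)]
  have "inv x \<otimes> inv y \<otimes> x \<otimes> y = (inv x \<otimes> inv x) \<otimes> ((x \<otimes> inv y) \<otimes> (x \<otimes> inv y)) \<otimes> (y \<otimes> y)"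
    using x y by (simp add: m_assoc)
  then show ?thesis
    using sq[of "inv x"] sq[of "x \<otimes> inv y"] sq[of y] x y
      subgroup.m_closed[OF normal_imp_subgroup[OF assms(1)]] by simp
qed

text \<open>\<open>b\<^sup>2 c\<close> generates the direct product of \<open>\<langle>b\<rangle>\<close>, of odd order, and \<open>\<langle>c\<rangle>\<close>, of order at most two.\<close>

lemma odd_times_two_cyclic:
  assumes bc: "b \<in> carrier G" "c \<in> carrier G" "b \<otimes> c = c \<otimes> b"
    and m: "odd m" "b [^] (m::nat) = \<one>" and c2: "c \<otimes> c = \<one>"
    and z: "z = b [^] (2::nat) \<otimes> c"
  shows "z [^] m = c" "\<exists>k::nat. z [^] k = b"
    "\<And>k::nat. z [^] k \<otimes> z [^] k = \<one> \<Longrightarrow> z [^] k = \<one> \<or> z [^] k = c"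
proof -
  obtain a where a: "m = 2 * a + 1" using m(1) by (rule oddE)
  have comm: "b [^] i \<otimes> c = c \<otimes> b [^] i" for i :: nat
    using bc by (simp add: group_commutes_pow)
  have zpow: "z [^] k = b [^] (2 * k) \<otimes> c [^] k" for k :: nat
    unfolding z using bc comm by (subst pow_mult_distrib) (auto simp: nat_pow_pow)
  have c_even: "c [^] (2 * k) = \<one>" for k :: nat
    using bc c2 nat_pow_pow[of c 2 k] by (simp add: numeral_2_eq_2)
  have c_odd: "c [^] (2 * k + 1) = c" for k :: nat
    using bc c_even[of k] by simp
  have bm: "b [^] (m * k) = \<one>" for k :: nat
    using bc m nat_pow_pow[of b m k] by simp
  show zm: "z [^] m = c"
    using bm[of 2] c_odd[of a] bc unfolding zpow by (simp add: a mult.commute)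
  \<comment> \<open>The exponent is even, which kills \<open>c\<close>, and its double is
    \<open>(m + 1)^2 = m (m + 2) + 1\<close>, which leaves \<open>b\<close>.\<close>
  have "z [^] (2 * (a + 1)^2) = b [^] (m * (m + 2) + 1) \<otimes> c [^] (2 * (a + 1)^2)"
    unfolding zpow a by (simp add: power2_eq_square algebra_simps)
  also have "\<dots> = b" unfolding c_even using bm[of "m + 2"] bc by simp
  finally show "\<exists>k::nat. z [^] k = b" by blast
  fix k :: nat assume k: "z [^] k \<otimes> z [^] k = \<one>"
  have zc: "z \<in> carrier G" using z bc by simp
  \<comment> \<open>Since \<open>m\<close> is odd, an element with trivial square equals its own
    \<open>m\<close>-th power, and here that power is \<open>(z^m)^k = c^k\<close>.\<close>
  have "(z [^] k) [^] m = z [^] k"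
    using k zc nat_pow_pow[of "z [^] k" 2 a] unfolding a
    by (simp add: numeral_2_eq_2 del: nat_pow_pow)
  moreover have "(z [^] k) [^] m = c [^] k"
    using zc nat_pow_pow[of z k m] nat_pow_pow[of z m k] by (simp add: mult.commute zm)
  moreover have "c [^] k = \<one> \<or> c [^] k = c"
    using c_even c_odd by (cases "even k") (auto elim!: evenE oddE)
  ultimately show "z [^] k = \<one> \<or> z [^] k = c" by metis
qed

end

lemma comm_group_elem_ab: "comm_group (elem_ab p k)"
proof (rule group.group_comm_groupI)
  show "group (elem_ab p k)" by (simp add: elem_ab_def)
qed (auto simp: elem_ab_def add.commute)

lemma card_elem_ab:
  assumes "p > 0" shows "card (carrier (elem_ab p k)) = p ^ k"
  using assms by (simp add: elem_ab_def card_PiE carrier_integer_mod_group)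

lemma iso_elem_ab:
  assumes "group G" "G \<cong> elem_ab p k" "p > 0"
  shows "card (carrier G) = p ^ k" "comm_group G"
proof -
  show "card (carrier G) = p ^ k" using card_elem_ab[OF assms(3)] iso_same_card[OF assms(2)] by simp
  have "elem_ab p k \<cong> G" using assms(1,2) by (simp add: group.iso_sym)
  then show "comm_group G"
    using comm_group.iso_imp_comm_group[OF comm_group_elem_ab] assms(1) group.is_monoid by blast
qed

section \<open>The wreath product with a cyclic group\<close>

locale cyclic_wreath = Y: group Y for Y (structure) +
  fixes n :: nat
  assumes n_pos: "n > 0"
begin

abbreviation "W \<equiv> wreath Y n"

lemma W_carrier_iff:
  "w \<in> carrier W \<longleftrightarrow> fst w \<in> extensional {0..<n} \<and> (\<forall>i<n. fst w i \<in> carrier Y) \<and> snd w < n"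
  by (cases w) (auto simp: wreath_def PiE_def)

lemma base_pow_iff:
  "w \<in> base_pow n S \<longleftrightarrow> fst w \<in> extensional {0..<n} \<and> (\<forall>i<n. fst w i \<in> S) \<and> snd w = 0"
  by (cases w) (auto simp: base_pow_def PiE_def)

lemma W_mult_fst: "i < n \<Longrightarrow> fst (v \<otimes>\<^bsub>W\<^esub> w) i = fst v i \<otimes> fst w ((i + snd v) mod n)"
  by (cases v; cases w) (simp add: wreath_def)

lemma W_mult_snd: "snd (v \<otimes>\<^bsub>W\<^esub> w) = (snd v + snd w) mod n"
  by (cases v; cases w) (simp add: wreath_def)

lemma W_mult_ext: "fst (v \<otimes>\<^bsub>W\<^esub> w) \<in> extensional {0..<n}"
  by (cases v; cases w) (simp add: wreath_def)

lemma W_one: "\<one>\<^bsub>W\<^esub> = (\<lambda>i\<in>{0..<n}. \<one>, 0)"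
  by (simp add: wreath_def)

lemma W_eqI:
  assumes "fst v \<in> extensional {0..<n}" "fst w \<in> extensional {0..<n}"
    "\<And>i. i < n \<Longrightarrow> fst v i = fst w i" "snd v = snd w"
  shows "v = w"
  using assms by (intro prod_eqI) (auto intro: extensionalityI)

lemma W_closed: "v \<in> carrier W \<Longrightarrow> w \<in> carrier W \<Longrightarrow> v \<otimes>\<^bsub>W\<^esub> w \<in> carrier W"
  using n_pos by (simp add: W_carrier_iff W_mult_fst W_mult_snd W_mult_ext)

lemma group_W: "group W"
proof (rule groupI)
  show "\<one>\<^bsub>W\<^esub> \<in> carrier W" using n_pos by (simp add: W_carrier_iff W_one)
  show "u \<otimes>\<^bsub>W\<^esub> v \<otimes>\<^bsub>W\<^esub> w = u \<otimes>\<^bsub>W\<^esub> (v \<otimes>\<^bsub>W\<^esub> w)"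
    if "u \<in> carrier W" "v \<in> carrier W" "w \<in> carrier W" for u v w
  proof (rule W_eqI)
    show "fst (u \<otimes>\<^bsub>W\<^esub> v \<otimes>\<^bsub>W\<^esub> w) i = fst (u \<otimes>\<^bsub>W\<^esub> (v \<otimes>\<^bsub>W\<^esub> w)) i" if i: "i < n" for i
    proof -
      have "(i + (snd u + snd v) mod n) mod n = ((i + snd u) mod n + snd v) mod n"
        by (simp add: mod_simps add.assoc)
      then show ?thesis
        using i n_pos \<open>u \<in> _\<close> \<open>v \<in> _\<close> \<open>w \<in> _\<close>
        by (simp add: W_mult_fst W_mult_snd W_carrier_iff Y.m_assoc)
    qed
  qed (auto simp: W_mult_ext W_mult_snd mod_simps add.assoc)
  show "\<one>\<^bsub>W\<^esub> \<otimes>\<^bsub>W\<^esub> w = w" if "w \<in> carrier W" for w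
    using that n_pos by (intro W_eqI) (auto simp: W_mult_ext W_mult_snd W_mult_fst W_carrier_iff W_one)
  show "\<exists>v\<in>carrier W. v \<otimes>\<^bsub>W\<^esub> w = \<one>\<^bsub>W\<^esub>" if w: "w \<in> carrier W" for w
  proof
    \<comment> \<open>The rotation that cancels \<open>snd w\<close>; the outer \<open>mod n\<close>
      covers the case \<open>snd w = 0\<close>. The coordinates of the inverse are shifted by
      \<open>k\<close>, as the product reads its right factor at \<open>i + k\<close>.\<close>
    define k where "k = (n - snd w) mod n"
    let ?v = "(\<lambda>i\<in>{0..<n}. inv (fst w ((i + k) mod n)), k)"
    show "?v \<in> carrier W" using w n_pos by (auto simp: W_carrier_iff k_def)
    have "(k + snd w) mod n = 0" using w by (simp add: k_def W_carrier_iff mod_simps)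
    then show "?v \<otimes>\<^bsub>W\<^esub> w = \<one>\<^bsub>W\<^esub>"
      using w n_pos by (intro W_eqI) (auto simp: W_mult_ext W_mult_snd W_mult_fst W_carrier_iff W_one)
  qed
qed (rule W_closed)

sublocale W: group W by (rule group_W)

lemma base_carrier: "S \<subseteq> carrier Y \<Longrightarrow> w \<in> base_pow n S \<Longrightarrow> w \<in> carrier W"
  using n_pos by (auto simp: base_pow_iff W_carrier_iff)

lemma base_mult_fst: "snd v = 0 \<Longrightarrow> i < n \<Longrightarrow> fst (v \<otimes>\<^bsub>W\<^esub> w) i = fst v i \<otimes> fst w i"
  by (simp add: W_mult_fst)

lemma base_inv:
  assumes w: "w \<in> carrier W" "snd w = 0"
  shows "snd (inv\<^bsub>W\<^esub> w) = 0" "\<And>i. i < n \<Longrightarrow> fst (inv\<^bsub>W\<^esub> w) i = inv (fst w i)"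
proof -
  let ?v = "(\<lambda>i\<in>{0..<n}. inv (fst w i), 0)"
  have "?v \<in> carrier W" using w n_pos by (auto simp: W_carrier_iff)
  moreover have "?v \<otimes>\<^bsub>W\<^esub> w = \<one>\<^bsub>W\<^esub>"
    using w n_pos by (intro W_eqI) (auto simp: W_mult_ext W_mult_snd W_mult_fst W_carrier_iff W_one)
  ultimately have "inv\<^bsub>W\<^esub> w = ?v" using w W.inv_equality by blast
  then show "snd (inv\<^bsub>W\<^esub> w) = 0" "\<And>i. i < n \<Longrightarrow> fst (inv\<^bsub>W\<^esub> w) i = inv (fst w i)" by auto
qed

lemma base_pow_subgroup:
  assumes S: "subgroup S Y" shows "subgroup (base_pow n S) W"
proof
  have sub: "base_pow n S \<subseteq> carrier W" using base_carrier subgroup.subset[OF S] by blast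
  then show "base_pow n S \<subseteq> carrier W" .
  show "\<one>\<^bsub>W\<^esub> \<in> base_pow n S" using subgroup.one_closed[OF S] by (simp add: base_pow_iff W_one)
  show "v \<otimes>\<^bsub>W\<^esub> w \<in> base_pow n S" if "v \<in> base_pow n S" "w \<in> base_pow n S" for v w
    using that subgroup.m_closed[OF S] by (simp add: base_pow_iff W_mult_ext W_mult_snd W_mult_fst)
  show "inv\<^bsub>W\<^esub> w \<in> base_pow n S" if "w \<in> base_pow n S" for w
  proof -
    have "w \<in> carrier W" using that sub by blast
    then show ?thesis
      using that base_inv[of w] W.inv_closed[of w] subgroup.m_inv_closed[OF S]
      by (auto simp: base_pow_iff W_carrier_iff)
  qed
qed

text \<open>Conjugation by \<open>w\<close> rotates the coordinates and then conjugates the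
  \<open>i\<close>-th one by \<open>fst w i\<close>; both operations preserve
  \<open>T\<close>.\<close>

lemma base_pow_normal:
  assumes T: "T \<lhd> Y" shows "base_pow n T \<lhd> W"
proof (rule W.normal_invI)
  have sT: "subgroup T Y" using T normal_imp_subgroup by blast
  show "subgroup (base_pow n T) W" using base_pow_subgroup[OF sT] .
  fix w v assume w: "w \<in> carrier W" and v: "v \<in> base_pow n T"
  let ?u = "(\<lambda>i\<in>{0..<n}. fst w i \<otimes> fst v ((i + snd w) mod n) \<otimes> inv (fst w i), 0)"
  have vT: "fst v ((i + snd w) mod n) \<in> T" for i using v n_pos by (simp add: base_pow_iff)
  have u: "?u \<in> base_pow n T"
    using w vT normal.inv_op_closed2[OF T] by (simp add: base_pow_iff W_carrier_iff)
  have vW: "v \<in> carrier W" "?u \<in> carrier W"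
    using u v base_carrier subgroup.subset[OF sT] by blast+
  have "w \<otimes>\<^bsub>W\<^esub> v = ?u \<otimes>\<^bsub>W\<^esub> w"
    using w v vT subgroup.mem_carrier[OF sT]
    by (intro W_eqI) (auto simp: W_mult_ext W_mult_fst W_mult_snd W_carrier_iff base_pow_iff Y.m_assoc)
  then have "w \<otimes>\<^bsub>W\<^esub> v \<otimes>\<^bsub>W\<^esub> inv\<^bsub>W\<^esub> w = ?u" using w vW by (simp add: W.m_assoc)
  then show "w \<otimes>\<^bsub>W\<^esub> v \<otimes>\<^bsub>W\<^esub> inv\<^bsub>W\<^esub> w \<in> base_pow n T" using u by simp
qed

lemma snd_pow: "snd (w [^]\<^bsub>W\<^esub> k) = (k * snd w) mod n" for k :: nat
proof (induction k)
  case (Suc k)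
  then show ?case by (simp add: W_mult_snd mod_simps add.commute)
qed (simp add: W_one)

lemma base_pow_fst:
  fixes k :: nat
  assumes "snd w = 0" "i < n"
  shows "fst (w [^]\<^bsub>W\<^esub> k) i = fst w i [^] k"
  using assms by (induction k) (simp_all add: W_one W_mult_fst snd_pow)

lemma base_iff: "w \<in> base_pow n (carrier Y) \<longleftrightarrow> w \<in> carrier W \<and> snd w = 0"
  using n_pos by (auto simp: base_pow_iff W_carrier_iff)

lemma finite_W: "finite (carrier Y) \<Longrightarrow> finite (carrier W)"
  by (simp add: wreath_def finite_PiE)

lemma diag_pow:
  assumes "x \<in> carrier Y"
  shows "(\<lambda>i\<in>{0..<n}. x, 0) [^]\<^bsub>W\<^esub> (k::nat) = (\<lambda>i\<in>{0..<n}. x [^] k, 0)"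
proof (rule W_eqI)
  have "(\<lambda>i\<in>{0..<n}. x, 0) \<in> carrier W" using assms n_pos by (simp add: W_carrier_iff)
  from W.nat_pow_closed[OF this, of k]
  show "fst ((\<lambda>i\<in>{0..<n}. x, 0) [^]\<^bsub>W\<^esub> k) \<in> extensional {0..<n}" by (simp add: W_carrier_iff)
qed (auto simp: base_pow_fst snd_pow)

end

context cyclic_wreath begin

lemma proj_hom:
  assumes L: "subgroup L W" "L \<subseteq> base_pow n (carrier Y)" and i: "i < n"
  shows "group_hom (W\<lparr>carrier := L\<rparr>) Y (\<lambda>w. fst w i)"
proof (rule group_hom.intro[OF W.subgroup_imp_group[OF L(1)] Y.group_axioms])
  show "group_hom_axioms (W\<lparr>carrier := L\<rparr>) Y (\<lambda>w. fst w i)"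
    using L(2) i by (intro group_hom_axioms.intro homI) (auto simp: base_pow_iff base_mult_fst)
qed

text \<open>Goursat's argument: the elements of \<open>L\<close> trivial on a set \<open>S\<close> of coordinates project
  to a normal subgroup of \<open>Y\<close> in every other coordinate; taking commutators lets \<open>S\<close> grow
  one coordinate at a time, because \<open>T\<close> is simple and not abelian.\<close>

lemma base_pow_subset_subdirect:
  assumes T: "T \<lhd> Y" "simple_group (Y\<lparr>carrier := T\<rparr>)"
    and nonab: "\<exists>t\<in>T. \<exists>u\<in>T. t \<otimes> u \<noteq> u \<otimes> t"
    and L: "subgroup L W"
    and proj: "\<And>j x. j < n \<Longrightarrow> x \<in> carrier Y \<Longrightarrow> \<exists>w\<in>L. snd w = 0 \<and> fst w j = x"
    and nontriv: "\<And>j. j < n \<Longrightarrow> \<exists>w\<in>L \<inter> base_pow n T. fst w j \<noteq> \<one>"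
    and sep: "\<And>i j. i < n \<Longrightarrow> j < n \<Longrightarrow> i \<noteq> j \<Longrightarrow>
      \<exists>w\<in>L \<inter> base_pow n T. fst w i = \<one> \<and> fst w j \<noteq> \<one>"
  shows "base_pow n T \<subseteq> L"
proof -
  have sT: "subgroup T Y" using T(1) by (rule normal_imp_subgroup)
  \<comment> \<open>The part of \<open>L\<close> inside \<open>T^n\<close> that vanishes on the
    coordinates in \<open>S\<close>.\<close>
  define M where "M S = {w \<in> L \<inter> base_pow n T. \<forall>i\<in>S. fst w i = \<one>}" for S
  have TY: "t \<in> carrier Y" if "t \<in> T" for t using that subgroup.mem_carrier[OF sT] by simp
  have MW: "w \<in> carrier W" "snd w = 0" "\<And>i. i < n \<Longrightarrow> fst w i \<in> T" if "w \<in> M S" for w S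
    using that base_carrier[OF subgroup.subset[OF sT]] by (auto simp: M_def base_pow_iff)
  have LB: "subgroup (L \<inter> base_pow n T) W"
    using L base_pow_subgroup[OF sT] W.subgroups_Inter_pair by blast
  have M_mult: "v \<otimes>\<^bsub>W\<^esub> w \<in> M S" if "v \<in> M S" "w \<in> M S" "S \<subseteq> {0..<n}" for v w S
    using that MW[OF that(1)] subgroup.m_closed[OF LB] unfolding M_def
    by (auto simp: base_mult_fst subset_iff)
  have M_inv: "inv\<^bsub>W\<^esub> w \<in> M S" if "w \<in> M S" "S \<subseteq> {0..<n}" for w S
    using that MW[OF that(1)] subgroup.m_inv_closed[OF LB] unfolding M_def
    by (auto simp: base_inv subset_iff)
  have M_one: "\<one>\<^bsub>W\<^esub> \<in> M S" if "S \<subseteq> {0..<n}" for S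
    using that subgroup.one_closed[OF LB] unfolding M_def by (auto simp: W_one subset_iff)
  have M_conj: "v \<otimes>\<^bsub>W\<^esub> w \<otimes>\<^bsub>W\<^esub> inv\<^bsub>W\<^esub> v \<in> M S"
    if v: "v \<in> L" "snd v = 0" and w: "w \<in> M S" and S: "S \<subseteq> {0..<n}" for v w S
  proof -
    have vW: "v \<in> carrier W" using subgroup.mem_carrier[OF L v(1)] .
    have "v \<otimes>\<^bsub>W\<^esub> w \<otimes>\<^bsub>W\<^esub> inv\<^bsub>W\<^esub> v \<in> L"
      using v(1) w subgroup.m_closed[OF L] subgroup.m_inv_closed[OF L] by (auto simp: M_def)
    moreover have "v \<otimes>\<^bsub>W\<^esub> w \<otimes>\<^bsub>W\<^esub> inv\<^bsub>W\<^esub> v \<in> base_pow n T"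
      using normal.inv_op_closed2[OF base_pow_normal[OF T(1)] vW] w by (auto simp: M_def)
    moreover have "fst (v \<otimes>\<^bsub>W\<^esub> w \<otimes>\<^bsub>W\<^esub> inv\<^bsub>W\<^esub> v) i = \<one>" if "i \<in> S" for i
      using that S vW v(2) w MW[OF w] base_inv[OF vW v(2)]
      by (auto simp: W_mult_fst W_mult_snd M_def subset_iff W_carrier_iff)
    ultimately show ?thesis by (simp add: M_def)
  qed
  \<comment> \<open>Because \<open>L\<close> projects onto \<open>Y\<close>, the image of
    \<open>M S\<close> in coordinate \<open>j\<close> is normal in \<open>Y\<close>; it lies in the
    simple group \<open>T\<close>, so as soon as it is nontrivial it is all of
    \<open>T\<close>.\<close>
  have full: "\<exists>w\<in>M S. fst w j = t"
    if S: "S \<subseteq> {0..<n}" and j: "j < n" and ex: "\<exists>w\<in>M S. fst w j \<noteq> \<one>" and t: "t \<in> T" for S j t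
  proof -
    define P where "P = (\<lambda>w. fst w j) ` M S"
    have "P \<lhd> Y"
    proof (rule Y.normal_invI)
      show "subgroup P Y"
      proof
        show "P \<subseteq> carrier Y" using MW(3) TY j unfolding P_def by blast
        show "\<one> \<in> P" using M_one[OF S] j unfolding P_def by (force simp: W_one)
        fix x y assume "x \<in> P" "y \<in> P"
        then obtain v w where vw: "v \<in> M S" "w \<in> M S" "x = fst v j" "y = fst w j"
          unfolding P_def by blast
        have "x \<otimes> y = fst (v \<otimes>\<^bsub>W\<^esub> w) j" using vw j MW(2)[OF vw(1)] by (simp add: base_mult_fst)
        then show "x \<otimes> y \<in> P" using M_mult vw(1,2) S unfolding P_def by blast
        have "inv x = fst (inv\<^bsub>W\<^esub> v) j" using vw j MW(1,2)[OF vw(1)] by (simp add: base_inv)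
        then show "inv x \<in> P" using M_inv vw(1) S unfolding P_def by blast
      qed
      fix x y assume x: "x \<in> carrier Y" and "y \<in> P"
      then obtain w where w: "w \<in> M S" "y = fst w j" unfolding P_def by blast
      obtain v where v: "v \<in> L" "snd v = 0" "fst v j = x" using proj[OF j x] by blast
      have vW: "v \<in> carrier W" using subgroup.mem_carrier[OF L v(1)] .
      have "x \<otimes> y \<otimes> inv x = fst (v \<otimes>\<^bsub>W\<^esub> w \<otimes>\<^bsub>W\<^esub> inv\<^bsub>W\<^esub> v) j"
        using v w j MW(2)[OF w(1)] base_inv[OF vW v(2)] by (simp add: W_mult_fst W_mult_snd)
      then show "x \<otimes> y \<otimes> inv x \<in> P" using M_conj[OF v(1,2) w(1) S] unfolding P_def by blast
    qed
    moreover have "P \<subseteq> T" using MW(3) j unfolding P_def by blast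
    ultimately have "P \<lhd> Y\<lparr>carrier := T\<rparr>" using Y.normal_restrict_supergroup[OF sT] by blast
    then have "P = T \<or> P = {\<one>}"
      using simple_group.no_real_normal_subgroup[OF T(2), of P] by simp
    then show ?thesis using ex t unfolding P_def by auto
  qed
  \<comment> \<open>Induction on the set of vanishing coordinates: \<open>nontriv\<close> starts it
    and \<open>sep\<close> adds one coordinate.\<close>
  have all: "\<exists>w\<in>M S. fst w j = t" if "finite S" "S \<subseteq> {0..<n}" "j < n" "j \<notin> S" "t \<in> T" for S j t
    using that
  proof (induction arbitrary: t rule: finite_induct)
    case empty
    obtain w where "w \<in> L \<inter> base_pow n T" "fst w j \<noteq> \<one>" using nontriv[OF empty(2)] ..
    then have "\<exists>w\<in>M {}. fst w j \<noteq> \<one>" by (intro bexI[of _ w]) (simp_all add: M_def)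
    then show ?case using full[of "{}" j t] empty by auto
  next
    case (insert i S)
    obtain s u where su: "s \<in> T" "u \<in> T" "s \<otimes> u \<noteq> u \<otimes> s" using nonab by blast
    obtain v where v: "v \<in> M S" "fst v j = s" using insert.IH[of s] insert.prems su by auto
    have "i < n" "j < n" "i \<noteq> j" using insert.prems by auto
    from sep[OF this] obtain x where "x \<in> L \<inter> base_pow n T" "fst x i = \<one> \<and> fst x j \<noteq> \<one>" ..
    then have "\<exists>w\<in>M {i}. fst w j \<noteq> \<one>" by (intro bexI[of _ x]) (simp_all add: M_def)
    then obtain w where w: "w \<in> M {i}" "fst w j = u"
      using full[of "{i}" j u] insert.prems su by auto
    \<comment> \<open>The commutator of \<open>v\<close>, trivial on \<open>S\<close>, and
      \<open>w\<close>, trivial at \<open>i\<close>, is trivial on both, while at \<open>j\<close>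
      it is the nontrivial commutator of \<open>s\<close> and \<open>u\<close>.\<close>
    define k where "k = v \<otimes>\<^bsub>W\<^esub> w \<otimes>\<^bsub>W\<^esub> inv\<^bsub>W\<^esub> v \<otimes>\<^bsub>W\<^esub> inv\<^bsub>W\<^esub> w"
    note vW = MW[OF v(1)] and wW = MW[OF w(1)]
    have vL: "v \<in> L" and wL: "w \<in> L" using v(1) w(1) by (auto simp: M_def)
    have "v \<otimes>\<^bsub>W\<^esub> w \<otimes>\<^bsub>W\<^esub> inv\<^bsub>W\<^esub> v \<in> M {i}"
      using M_conj[OF vL vW(2) w(1)] insert.prems by auto
    then have k1: "k \<in> M {i}" unfolding k_def
      using M_mult M_inv w(1) insert.prems by auto
    have "w \<otimes>\<^bsub>W\<^esub> inv\<^bsub>W\<^esub> v \<otimes>\<^bsub>W\<^esub> inv\<^bsub>W\<^esub> w \<in> M S"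
      using M_conj[OF wL wW(2) M_inv[OF v(1)]] insert.prems by auto
    then have "v \<otimes>\<^bsub>W\<^esub> (w \<otimes>\<^bsub>W\<^esub> inv\<^bsub>W\<^esub> v \<otimes>\<^bsub>W\<^esub> inv\<^bsub>W\<^esub> w) \<in> M S"
      using M_mult[OF v(1)] insert.prems by auto
    then have k2: "k \<in> M S" unfolding k_def using vW wW by (simp add: W.m_assoc)
    have "fst k j = s \<otimes> u \<otimes> inv s \<otimes> inv u"
      unfolding k_def using v w vW wW insert.prems by (simp add: W_mult_fst W_mult_snd base_inv)
    moreover have "s \<otimes> u \<otimes> inv s \<otimes> inv u \<noteq> \<one>"
    proof
      assume "s \<otimes> u \<otimes> inv s \<otimes> inv u = \<one>"
      then have "s \<otimes> u \<otimes> inv (u \<otimes> s) = \<one>" using su TY by (simp add: Y.m_assoc Y.inv_mult_group)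
      then have "s \<otimes> u = inv (inv (u \<otimes> s))" using su TY by (intro Y.inv_equality[symmetric]) auto
      then show False using su TY by simp
    qed
    moreover have "k \<in> M (insert i S)" using k1 k2 by (auto simp: M_def)
    ultimately have "\<exists>w\<in>M (insert i S). fst w j \<noteq> \<one>" by (intro bexI[of _ k]) simp_all
    then show ?case by (rule full[OF insert.prems(1,2) _ insert.prems(4)])
  qed
  show ?thesis
  proof
    fix x assume x: "x \<in> base_pow n T"
    \<comment> \<open>An element of \<open>T^n\<close> is built one coordinate at a time, each
      factor being supported in a single coordinate.\<close>
    define cut where "cut k = (\<lambda>i\<in>{0..<n}. if i < k then fst x i else \<one>, 0::nat)" for k
    have "cut k \<in> L" if "k \<le> n" for k
      using that
    proof (induction k)
      case 0
      have "cut 0 = \<one>\<^bsub>W\<^esub>" by (simp add: cut_def W_one)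
      then show ?case using subgroup.one_closed[OF L] by simp
    next
      case (Suc k)
      have "fst x k \<in> T" using x Suc.prems by (simp add: base_pow_iff)
      then obtain w where w: "w \<in> M ({0..<n} - {k})" "fst w k = fst x k"
        using all[of "{0..<n} - {k}" k "fst x k"] Suc.prems by auto
      have "cut (Suc k) = cut k \<otimes>\<^bsub>W\<^esub> w"
      proof (rule W_eqI)
        fix i assume i: "i < n"
        have "fst w i = \<one>" if "i \<noteq> k" using that w(1) i by (simp add: M_def)
        moreover have "fst x i \<in> carrier Y" using x i TY by (simp add: base_pow_iff)
        ultimately show "fst (cut (Suc k)) i = fst (cut k \<otimes>\<^bsub>W\<^esub> w) i"
          using i w(2) by (auto simp: W_mult_fst cut_def less_Suc_eq)
      qed (use MW[OF w(1)] in \<open>auto simp: cut_def W_mult_ext W_mult_snd\<close>)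
      then show ?case using Suc w(1) subgroup.m_closed[OF L] by (simp add: M_def)
    qed
    then have "cut n \<in> L" by simp
    moreover have "cut n = x" using x by (intro W_eqI) (auto simp: cut_def base_pow_iff)
    ultimately show "x \<in> L" by simp
  qed
qed

text \<open>In \<open>n\<close> steps each coordinate passes every position of the cycle once; it
  collects \<open>n\<close> factors \<open>b\<close> but only \<open>n - 1\<close> factors
  \<open>c\<close>, as position 1 contributes none.\<close>

lemma twisted_cycle_pow:
  assumes bc: "b \<in> carrier Y" "c \<in> carrier Y" "b \<otimes> c = c \<otimes> b" and n: "n > 1"
    and th: "\<theta> = (\<lambda>i\<in>{0..<n}. if i = 1 then b else b \<otimes> c, 1)"
  shows "\<theta> [^]\<^bsub>W\<^esub> n = (\<lambda>i\<in>{0..<n}. b [^] n \<otimes> c [^] (n - 1), 0)"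
proof -
  have thW: "\<theta> \<in> carrier W" using bc n by (auto simp: th W_carrier_iff)
  have comm: "b [^] i \<otimes> c [^] j = c [^] j \<otimes> b [^] i" for i j :: nat
    using bc by (metis Y.group_commutes_pow Y.nat_pow_closed)
  \<comment> \<open>Step \<open>j\<close> multiplies coordinate \<open>i\<close> by the entry of
    \<open>\<theta>\<close> at position \<open>i + j\<close>, so the exponent of \<open>c\<close>
    counts the steps that avoid position 1.\<close>
  have pow: "fst (\<theta> [^]\<^bsub>W\<^esub> k) i = b [^] k \<otimes> c [^] card {j. j < k \<and> (i + j) mod n \<noteq> 1}"
    if i: "i < n" for k i
  proof (induction k)
    case 0
    then show ?case using i by (simp add: W_one)
  next
    case (Suc k)
    let ?m = "\<lambda>k. card {j. j < k \<and> (i + j) mod n \<noteq> 1}"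
    have "fst (\<theta> [^]\<^bsub>W\<^esub> Suc k) i = b [^] k \<otimes> c [^] ?m k \<otimes> fst \<theta> ((i + k) mod n)"
      using Suc i by (simp add: W_mult_fst snd_pow th mod_simps)
    also have "\<dots> = b [^] Suc k \<otimes> c [^] ?m (Suc k)"
    proof (cases "(i + k) mod n = 1")
      case True
      then have "{j. j < Suc k \<and> (i + j) mod n \<noteq> 1} = {j. j < k \<and> (i + j) mod n \<noteq> 1}"
        by (auto simp: less_Suc_eq)
      then have "?m (Suc k) = ?m k" by simp
      moreover have "b [^] k \<otimes> c [^] ?m k \<otimes> b = b [^] k \<otimes> b \<otimes> c [^] ?m k"
        using bc comm[of 1 "?m k"] by (simp add: Y.m_assoc)
      ultimately show ?thesis using True n bc by (simp add: th)
    next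
      case False
      then have "{j. j < Suc k \<and> (i + j) mod n \<noteq> 1} = insert k {j. j < k \<and> (i + j) mod n \<noteq> 1}"
        by (auto simp: less_Suc_eq)
      then have "?m (Suc k) = Suc (?m k)" by simp
      moreover have "b [^] k \<otimes> c [^] ?m k \<otimes> (b \<otimes> c) = b [^] k \<otimes> b \<otimes> (c [^] ?m k \<otimes> c)"
      proof -
        have "c [^] ?m k \<otimes> (b \<otimes> c) = b \<otimes> (c [^] ?m k \<otimes> c)"
          using bc(1,2) comm[of 1 "?m k"] by (simp flip: Y.m_assoc)
        then show ?thesis using bc(1,2) by (simp add: Y.m_assoc)
      qed
      ultimately show ?thesis using False n_pos bc by (simp add: th)
    qed
    finally show ?case .
  qed
  have card: "card {j. j < n \<and> (i + j) mod n \<noteq> 1} = n - 1" if i: "i < n" for i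
  proof -
    \<comment> \<open>The one step at which coordinate \<open>i\<close> meets position 1; adding
      \<open>n\<close> keeps the subtraction within the naturals.\<close>
    define j0 where "j0 = (n + 1 - i) mod n"
    have j0: "j0 < n" "(i + j0) mod n = 1" using i n by (auto simp: j0_def mod_simps mod_Suc)
    have "(i + j) mod n = 1 \<longleftrightarrow> j = j0" if "j < n" for j
      using that j0 i by (auto simp: mod_if split: if_splits)
    then have "{j. j < n \<and> (i + j) mod n \<noteq> 1} = {0..<n} - {j0}" by auto
    then show ?thesis using j0 by simp
  qed
  show ?thesis
  proof (rule W_eqI)
    show "fst (\<theta> [^]\<^bsub>W\<^esub> n) \<in> extensional {0..<n}"
      using W.nat_pow_closed[OF thW, of n] by (simp add: W_carrier_iff)
  qed (use pow card in \<open>auto simp: snd_pow\<close>)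
qed

end

section \<open>The graph of the theorem\<close>

text \<open>The generators \<open>b\<close> and \<open>c\<close> are replaced by the single
  \<open>z\<close> that \<open>\<theta>^n\<close> repeats on the diagonal. \<open>F_z_triv\<close>
  says that \<open>z\<close> generates a complement to \<open>F\<close>-type elements: its powers
  meet \<open>F\<close> trivially. Almost simplicity enters only through the conditions on
  \<open>T\<close> and the non-normality of \<open>F\<close>.\<close>

locale coset_graph_setting = cyclic_wreath Y n for Y (structure) and n +
  fixes T F and z oi and E \<theta> and q :: nat
  assumes fin: "finite (carrier Y)" and n: "n = q + 1" and q: "q \<ge> 3"
    and T: "T \<lhd> Y" "simple_group (Y\<lparr>carrier := T\<rparr>)" "\<exists>t\<in>T. \<exists>u\<in>T. t \<otimes> u \<noteq> u \<otimes> t"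
    and T_comm: "\<And>x y. x \<in> carrier Y \<Longrightarrow> y \<in> carrier Y \<Longrightarrow> inv x \<otimes> inv y \<otimes> x \<otimes> y \<in> T"
    and F: "subgroup F Y" "card F = q" "\<not> F \<lhd> Y"
    and F_z: "\<And>f. f \<in> F \<Longrightarrow> z \<otimes> f \<otimes> inv z \<in> F" "\<And>f. f \<in> F \<Longrightarrow> inv z \<otimes> f \<otimes> z \<in> F"
    and F_z_triv: "\<And>k::nat. z [^] k \<in> F \<Longrightarrow> z [^] k = \<one>"
    and z: "z \<in> carrier Y" "z [^] (q - 1) = \<one>"
    and theta: "\<theta> \<in> carrier (wreath Y n)" "snd \<theta> = 1"
      "\<theta> [^]\<^bsub>wreath Y n\<^esub> n = (\<lambda>i\<in>{0..<n}. z, 0)"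
    and oi: "oi \<in> T" "oi \<noteq> \<one>" "oi \<otimes> oi = \<one>"
    and gen: "generate Y (F \<union> {z, oi}) = carrier Y"
    and oi_theta: "(\<lambda>i\<in>{0..<n}. oi, 0) \<otimes>\<^bsub>wreath Y n\<^esub> \<theta> \<otimes>\<^bsub>wreath Y n\<^esub> (\<lambda>i\<in>{0..<n}. oi, 0)
      \<in> generate (wreath Y n) {\<theta>}"
    and E: "subgroup E (wreath Y n)" "E \<subseteq> base_pow n (carrier Y)" "card E = q\<^sup>2"
    and E_proj: "\<And>i. i < n \<Longrightarrow> (\<lambda>w. fst w i) ` E = F"
    and E_ker: "\<And>i j. i < n \<Longrightarrow> j < n \<Longrightarrow> i \<noteq> j \<Longrightarrow> {w \<in> E. fst w i = \<one>} \<noteq> {w \<in> E. fst w j = \<one>}"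
    and E_norm: "\<And>d e. d \<in> generate (wreath Y n) {\<theta>} \<Longrightarrow> e \<in> E \<Longrightarrow>
      inv\<^bsub>wreath Y n\<^esub> d \<otimes>\<^bsub>wreath Y n\<^esub> e \<otimes>\<^bsub>wreath Y n\<^esub> d \<in> E"
    and E_trans: "\<And>e e'. e \<in> E - {\<one>\<^bsub>wreath Y n\<^esub>} \<Longrightarrow> e' \<in> E - {\<one>\<^bsub>wreath Y n\<^esub>} \<Longrightarrow>
      \<exists>d\<in>generate (wreath Y n) {\<theta>}. inv\<^bsub>wreath Y n\<^esub> d \<otimes>\<^bsub>wreath Y n\<^esub> e \<otimes>\<^bsub>wreath Y n\<^esub> d = e'"
begin

abbreviation "D \<equiv> generate W {\<theta>}"

definition "bo = (\<lambda>i\<in>{0..<n}. oi, 0::nat)"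

lemma T_sub: "subgroup T Y" using T(1) by (rule normal_imp_subgroup)

lemma oi_carrier: "oi \<in> carrier Y" using subgroup.mem_carrier[OF T_sub oi(1)] .

lemma E_W: "e \<in> E \<Longrightarrow> e \<in> carrier W" using subgroup.mem_carrier[OF E(1)] .

lemma E_snd: "e \<in> E \<Longrightarrow> snd e = 0" using E(2) base_iff by blast

section \<open>The cyclic group \<open>D\<close> and the diagonal involution\<close>

lemma D_eq: "D = {\<theta> [^]\<^bsub>W\<^esub> (k::nat) | k. True}"
  using W.generate_pow_on_finite_carrier[OF finite_W[OF fin] theta(1)] by simp

lemma theta_pow_D: "\<theta> [^]\<^bsub>W\<^esub> (k::nat) \<in> D" unfolding D_eq by blast

lemma D_sub: "subgroup D W" using W.generate_is_subgroup theta(1) by simp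

lemma D_W: "d \<in> D \<Longrightarrow> d \<in> carrier W" using subgroup.mem_carrier[OF D_sub] .

lemma bo_base: "bo \<in> base_pow n T" using oi(1) by (simp add: bo_def base_pow_iff)

lemma bo_W: "bo \<in> carrier W" using base_carrier[OF subgroup.subset[OF T_sub] bo_base] .

lemma bo_snd: "snd bo = 0" and bo_fst: "i < n \<Longrightarrow> fst bo i = oi" by (simp_all add: bo_def)

lemma bo_bo: "bo \<otimes>\<^bsub>W\<^esub> bo = \<one>\<^bsub>W\<^esub>"
  using oi(3) by (intro W_eqI) (auto simp: W_mult_ext W_mult_fst W_mult_snd W_one bo_def)

lemma bo_cancel: "w \<in> carrier W \<Longrightarrow> bo \<otimes>\<^bsub>W\<^esub> (bo \<otimes>\<^bsub>W\<^esub> w) = w"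
  using bo_bo bo_W by (simp flip: W.m_assoc)

lemma theta_pow_n: "\<theta> [^]\<^bsub>W\<^esub> (n * k) = (\<lambda>i\<in>{0..<n}. z [^] k, 0)" for k :: nat
  using W.nat_pow_pow[OF theta(1), of n k] diag_pow[OF z(1), of k] by (simp add: theta(3))

lemma theta_order: "\<theta> [^]\<^bsub>W\<^esub> (q\<^sup>2 - 1) = \<one>\<^bsub>W\<^esub>"
proof -
  have "q\<^sup>2 - 1 = n * (q - 1)" using n q by (simp add: power2_eq_square algebra_simps)
  then show ?thesis using theta_pow_n[of "q - 1"] z(2) by (simp add: W_one)
qed

lemma D_order: "d \<in> D \<Longrightarrow> d [^]\<^bsub>W\<^esub> (q\<^sup>2 - 1) = \<one>\<^bsub>W\<^esub>"
proof -
  assume "d \<in> D"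
  then obtain k :: nat where "d = \<theta> [^]\<^bsub>W\<^esub> k" unfolding D_eq by blast
  then have "d [^]\<^bsub>W\<^esub> (q\<^sup>2 - 1) = (\<theta> [^]\<^bsub>W\<^esub> (q\<^sup>2 - 1)) [^]\<^bsub>W\<^esub> k"
    using theta(1) by (simp add: W.nat_pow_pow mult.commute)
  then show ?thesis using theta_order by simp
qed

text \<open>Elements of \<open>E\<close> have no rotation part, so a power of
  \<open>\<theta>\<close> in \<open>E\<close> is a power of \<open>\<theta>^n\<close>: a diagonal
  element whose entry is a power of \<open>z\<close> in \<open>F\<close>.\<close>

lemma D_Int_E:
  assumes "d \<in> D" "d \<in> E" shows "d = \<one>\<^bsub>W\<^esub>"
proof -
  obtain k :: nat where k: "d = \<theta> [^]\<^bsub>W\<^esub> k" using assms(1) unfolding D_eq by blast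
  have "k mod n = 0" using E_snd[OF assms(2)] snd_pow[of \<theta> k] theta(2) k by simp
  then obtain l where "k = n * l" by (auto simp: mod_eq_0_iff_dvd elim: dvdE)
  then have d: "d = (\<lambda>i\<in>{0..<n}. z [^] l, 0)" using k theta_pow_n by simp
  then have "z [^] l \<in> F" using E_proj[OF n_pos] assms(2) n_pos by force
  then show ?thesis using d F_z_triv[of l] by (simp add: W_one)
qed

text \<open>Conjugation by the involution is multiplicative, so the hypothesis on the generator
  \<open>\<theta>\<close> suffices.\<close>

lemma bo_D: "d \<in> D \<Longrightarrow> bo \<otimes>\<^bsub>W\<^esub> d \<otimes>\<^bsub>W\<^esub> bo \<in> D"
proof -
  assume "d \<in> D"
  then obtain k :: nat where k: "d = \<theta> [^]\<^bsub>W\<^esub> k" unfolding D_eq by blast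
  have "bo \<otimes>\<^bsub>W\<^esub> \<theta> [^]\<^bsub>W\<^esub> k \<otimes>\<^bsub>W\<^esub> bo \<in> D"
  proof (induction k)
    case 0
    then show ?case using bo_W bo_bo subgroup.one_closed[OF D_sub] by simp
  next
    case (Suc k)
    have "bo \<otimes>\<^bsub>W\<^esub> \<theta> [^]\<^bsub>W\<^esub> Suc k \<otimes>\<^bsub>W\<^esub> bo = (bo \<otimes>\<^bsub>W\<^esub> \<theta> [^]\<^bsub>W\<^esub> k \<otimes>\<^bsub>W\<^esub> bo) \<otimes>\<^bsub>W\<^esub> (bo \<otimes>\<^bsub>W\<^esub> \<theta> \<otimes>\<^bsub>W\<^esub> bo)"
      using bo_W theta(1) by (simp add: W.m_assoc bo_cancel)
    then show ?case using Suc oi_theta[folded bo_def] subgroup.m_closed[OF D_sub] by simp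
  qed
  then show ?thesis using k by simp
qed

section \<open>\<open>E\<close> lies in the power of the socle\<close>

lemma E_nontriv: "\<exists>e. e \<in> E - {\<one>\<^bsub>W\<^esub>}"
proof (rule ccontr)
  assume "\<not> ?thesis"
  then have "E \<subseteq> {\<one>\<^bsub>W\<^esub>}" by blast
  then have "card E \<le> 1" by (metis card_mono finite.emptyI finite_insert is_singletonI is_singleton_altdef)
  moreover have "q * q \<ge> 3 * 3" using q mult_le_mono by blast
  ultimately show False using E(3) by (simp add: power2_eq_square)
qed

lemma E_T: "E \<subseteq> base_pow n T"
proof -
  obtain e where e: "e \<in> E - {\<one>\<^bsub>W\<^esub>}" using E_nontriv by blast
  note eW = E_W[of e] and tW = theta(1)
  let ?c = "\<lambda>k::nat. inv\<^bsub>W\<^esub> (\<theta> [^]\<^bsub>W\<^esub> k) \<otimes>\<^bsub>W\<^esub> e \<otimes>\<^bsub>W\<^esub> \<theta> [^]\<^bsub>W\<^esub> k"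
  \<comment> \<open>The commutator of \<open>e\<close> and \<open>\<theta>^n\<close>.\<close>
  define u where "u = inv\<^bsub>W\<^esub> e \<otimes>\<^bsub>W\<^esub> ?c n"
  have uE: "u \<in> E" unfolding u_def
    using e E_norm theta_pow_D subgroup.m_closed[OF E(1)] subgroup.m_inv_closed[OF E(1)] by blast
  have "u \<noteq> \<one>\<^bsub>W\<^esub>"
  proof
    assume "u = \<one>\<^bsub>W\<^esub>"
    moreover have "e \<otimes>\<^bsub>W\<^esub> u = ?c n" unfolding u_def
      using e eW tW by (intro W.inv_cancel_left) auto
    ultimately have cent: "?c n = e" using e eW by simp
    have step: "?c (n * l) = e" for l
    proof (induction l)
      case 0
      then show ?case using e eW by simp
    next
      case (Suc l)
      have "\<theta> [^]\<^bsub>W\<^esub> (n * Suc l) = \<theta> [^]\<^bsub>W\<^esub> (n * l) \<otimes>\<^bsub>W\<^esub> \<theta> [^]\<^bsub>W\<^esub> n"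
        using tW by (simp add: W.nat_pow_mult add.commute)
      then have "?c (n * Suc l) = inv\<^bsub>W\<^esub> (\<theta> [^]\<^bsub>W\<^esub> n) \<otimes>\<^bsub>W\<^esub> ?c (n * l) \<otimes>\<^bsub>W\<^esub> \<theta> [^]\<^bsub>W\<^esub> n"
        using e eW tW by (simp add: W.inv_mult_group W.m_assoc)
      then show ?case using Suc cent by simp
    qed
    \<comment> \<open>If \<open>\<theta>^n\<close> centralises \<open>e\<close>, the conjugate of
      \<open>e\<close> by \<open>\<theta>^k\<close> depends only on \<open>k mod n\<close>, so the
      \<open>D\<close>-orbit of \<open>e\<close> has at most \<open>n\<close> elements. It is all of
      \<open>E\<close> without the identity, of size \<open>q^2 - 1 > q + 1\<close>.\<close>
    have period: "?c k = ?c (k mod n)" for k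
    proof -
      have "\<theta> [^]\<^bsub>W\<^esub> k = \<theta> [^]\<^bsub>W\<^esub> (n * (k div n)) \<otimes>\<^bsub>W\<^esub> \<theta> [^]\<^bsub>W\<^esub> (k mod n)"
        using tW by (simp add: W.nat_pow_mult)
      then have "?c k = inv\<^bsub>W\<^esub> (\<theta> [^]\<^bsub>W\<^esub> (k mod n)) \<otimes>\<^bsub>W\<^esub> ?c (n * (k div n)) \<otimes>\<^bsub>W\<^esub> \<theta> [^]\<^bsub>W\<^esub> (k mod n)"
        using e eW tW by (simp add: W.inv_mult_group W.m_assoc)
      then show ?thesis using step by simp
    qed
    have "E - {\<one>\<^bsub>W\<^esub>} \<subseteq> ?c ` {0..<n}"
    proof
      fix e' assume "e' \<in> E - {\<one>\<^bsub>W\<^esub>}"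
      then obtain k :: nat where "e' = ?c k" using E_trans[OF e] unfolding D_eq by blast
      then have "e' = ?c (k mod n)" using period by simp
      then show "e' \<in> ?c ` {0..<n}" using n_pos by (intro image_eqI[of _ _ "k mod n"]) auto
    qed
    then have "card (E - {\<one>\<^bsub>W\<^esub>}) \<le> n"
      using card_mono[of "?c ` {0..<n}" "E - {\<one>\<^bsub>W\<^esub>}"] card_image_le[of "{0..<n}" ?c] by simp
    moreover have "card (E - {\<one>\<^bsub>W\<^esub>}) = q\<^sup>2 - 1"
      using E(3) subgroup.one_closed[OF E(1)] by (simp add: card_Diff_singleton)
    moreover have "q\<^sup>2 \<ge> 3 * q" using q by (simp add: power2_eq_square)
    ultimately show False using n q by linarith
  qed
  then have u: "u \<in> E - {\<one>\<^bsub>W\<^esub>}" using uE by simp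
  have "u \<in> base_pow n T" unfolding base_pow_iff
  proof (intro conjI allI impI)
    show "fst u \<in> extensional {0..<n}" "snd u = 0" using uE E(2) by (auto simp: base_pow_iff)
    fix i assume i: "i < n"
    have snd_t: "snd (\<theta> [^]\<^bsub>W\<^esub> n) = 0" "\<theta> [^]\<^bsub>W\<^esub> n \<in> carrier W" "fst (\<theta> [^]\<^bsub>W\<^esub> n) i = z"
      using W.nat_pow_closed[OF tW, of n] i by (simp_all add: theta(3))
    have ei: "fst e i \<in> carrier Y" "e \<in> carrier W" "snd e = 0"
      using e E_W E_snd i by (auto simp: W_carrier_iff)
    have "fst u i = inv (fst e i) \<otimes> (inv z \<otimes> fst e i \<otimes> z)"
      unfolding u_def using i base_inv[OF snd_t(2,1)] base_inv[OF ei(2,3)] ei snd_t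
      by (simp add: W_mult_fst W_mult_snd)
    also have "\<dots> = inv (fst e i) \<otimes> inv z \<otimes> fst e i \<otimes> z" using ei z by (simp add: Y.m_assoc)
    finally show "fst u i \<in> T" using T_comm[OF ei(1) z(1)] by simp
  qed
  \<comment> \<open>One nontrivial element suffices: its \<open>D\<close>-conjugates stay in the
    normal subgroup \<open>T^n\<close> and exhaust the non-identity elements of
    \<open>E\<close>.\<close>
  then have conj: "inv\<^bsub>W\<^esub> d \<otimes>\<^bsub>W\<^esub> u \<otimes>\<^bsub>W\<^esub> d \<in> base_pow n T" if "d \<in> D" for d
    using normal.inv_op_closed1[OF base_pow_normal[OF T(1)] D_W[OF that]] by blast
  show ?thesis
  proof
    fix e' assume e': "e' \<in> E"
    show "e' \<in> base_pow n T"
    proof (cases "e' = \<one>\<^bsub>W\<^esub>")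
      case True
      then show ?thesis using subgroup.one_closed[OF base_pow_subgroup[OF T_sub]] by simp
    next
      case False
      then show ?thesis using E_trans[OF u, of e'] e' conj by blast
    qed
  qed
qed

section \<open>The vertex stabiliser and its conjugate under the involution\<close>

definition "H = E <#>\<^bsub>W\<^esub> D"

lemma H_iff: "w \<in> H \<longleftrightarrow> (\<exists>e\<in>E. \<exists>d\<in>D. w = e \<otimes>\<^bsub>W\<^esub> d)"
  by (auto simp: H_def set_mult_def)

lemma D_conj_E: "d \<in> D \<Longrightarrow> e \<in> E \<Longrightarrow> d \<otimes>\<^bsub>W\<^esub> e \<otimes>\<^bsub>W\<^esub> inv\<^bsub>W\<^esub> d \<in> E"
  using E_norm[of "inv\<^bsub>W\<^esub> d" e] subgroup.m_inv_closed[OF D_sub] D_W by simp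

lemma H_sub: "subgroup H W"
  unfolding H_def using W.set_mult_subgroupI[OF E(1) D_sub] D_conj_E by blast

text \<open>\<open>D\<close> normalises \<open>E\<close>, so modulo \<open>E\<close> powers are
  taken in \<open>D\<close>.\<close>

lemma H_pow:
  assumes e: "e \<in> E" and d: "d \<in> D"
  shows "\<exists>e'\<in>E. (e \<otimes>\<^bsub>W\<^esub> d) [^]\<^bsub>W\<^esub> (k::nat) = e' \<otimes>\<^bsub>W\<^esub> d [^]\<^bsub>W\<^esub> k"
proof (induction k)
  case 0
  then show ?case using subgroup.one_closed[OF E(1)] by (intro bexI[of _ "\<one>\<^bsub>W\<^esub>"]) auto
next
  case (Suc k)
  then obtain e' where e': "e' \<in> E" "(e \<otimes>\<^bsub>W\<^esub> d) [^]\<^bsub>W\<^esub> k = e' \<otimes>\<^bsub>W\<^esub> d [^]\<^bsub>W\<^esub> k" by blast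
  let ?x = "d [^]\<^bsub>W\<^esub> k"
  have xD: "?x \<in> D"
    using d subgroup.one_closed[OF D_sub] subgroup.m_closed[OF D_sub] by (induction k) auto
  have "(e \<otimes>\<^bsub>W\<^esub> d) [^]\<^bsub>W\<^esub> Suc k = (e' \<otimes>\<^bsub>W\<^esub> (?x \<otimes>\<^bsub>W\<^esub> e \<otimes>\<^bsub>W\<^esub> inv\<^bsub>W\<^esub> ?x)) \<otimes>\<^bsub>W\<^esub> d [^]\<^bsub>W\<^esub> Suc k"
    using e' e d E_W D_W by (simp add: W.m_assoc)
  moreover have "e' \<otimes>\<^bsub>W\<^esub> (?x \<otimes>\<^bsub>W\<^esub> e \<otimes>\<^bsub>W\<^esub> inv\<^bsub>W\<^esub> ?x) \<in> E"
    using D_conj_E[OF xD e] e'(1) subgroup.m_closed[OF E(1)] by blast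
  ultimately show ?case by blast
qed

text \<open>\<open>E\<close> consists of all elements of \<open>H\<close> of order dividing \<open>q\<^sup>2\<close>, as \<open>H / E\<close> has order \<open>q\<^sup>2 - 1\<close>.\<close>

lemma H_torsion_E:
  assumes y: "y \<in> H" "y [^]\<^bsub>W\<^esub> q\<^sup>2 = \<one>\<^bsub>W\<^esub>" shows "y \<in> E"
proof -
  obtain e d where ed: "e \<in> E" "d \<in> D" "y = e \<otimes>\<^bsub>W\<^esub> d" using y(1) H_iff by blast
  note dW = D_W[OF ed(2)]
  obtain e' where e': "e' \<in> E" "e' \<otimes>\<^bsub>W\<^esub> d [^]\<^bsub>W\<^esub> q\<^sup>2 = \<one>\<^bsub>W\<^esub>"
    using H_pow[OF ed(1,2), of "q\<^sup>2"] y(2) ed(3) by auto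
  \<comment> \<open>The exponent is 1 modulo \<open>q^2 - 1\<close>, so \<open>d\<close> is its own
    \<open>q^2\<close>-th power; hence \<open>d\<close> is the inverse of \<open>e'\<close> and lies
    in both \<open>D\<close> and \<open>E\<close>.\<close>
  have "q\<^sup>2 = Suc (q\<^sup>2 - 1)" using q by simp
  then have "d [^]\<^bsub>W\<^esub> q\<^sup>2 = d [^]\<^bsub>W\<^esub> (q\<^sup>2 - 1) \<otimes>\<^bsub>W\<^esub> d" by (metis W.nat_pow_Suc)
  then have "d [^]\<^bsub>W\<^esub> q\<^sup>2 = d" using D_order[OF ed(2)] dW by simp
  then have "e' = inv\<^bsub>W\<^esub> d" using e' dW E_W W.inv_equality[of e' d] by simp
  then have "d \<in> E" using e'(1) dW subgroup.m_inv_closed[OF E(1) e'(1)] by simp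
  then have "d = \<one>\<^bsub>W\<^esub>" using D_Int_E ed(2) by blast
  then show ?thesis using ed E_W by simp
qed

lemma E_exponent: "e \<in> E \<Longrightarrow> e [^]\<^bsub>W\<^esub> q\<^sup>2 = \<one>\<^bsub>W\<^esub>"
proof -
  assume e: "e \<in> E"
  interpret EG: group "W\<lparr>carrier := E\<rparr>" using W.subgroup_imp_group[OF E(1)] .
  have "e [^]\<^bsub>W\<lparr>carrier := E\<rparr>\<^esub> order (W\<lparr>carrier := E\<rparr>) = \<one>\<^bsub>W\<^esub>" using EG.pow_order_eq_1[of e] e by simp
  then show ?thesis using E(3) W.nat_pow_consistent[of e "q\<^sup>2" E] by (simp add: order_def)
qed

lemma bo_conj_pow:
  "w \<in> carrier W \<Longrightarrow> (bo \<otimes>\<^bsub>W\<^esub> w \<otimes>\<^bsub>W\<^esub> bo) [^]\<^bsub>W\<^esub> (k::nat) = bo \<otimes>\<^bsub>W\<^esub> w [^]\<^bsub>W\<^esub> k \<otimes>\<^bsub>W\<^esub> bo"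
  using bo_W bo_bo by (induction k) (auto simp: W.m_assoc bo_cancel)

text \<open>In coordinate 0 the involution \<open>oi\<close> would normalise \<open>F\<close>; as
  \<open>F\<close> and \<open>z\<close> do too, and the three generate the whole group,
  \<open>F\<close> would be normal.\<close>

lemma bo_not_normalises_E:
  assumes "\<And>e. e \<in> E \<Longrightarrow> bo \<otimes>\<^bsub>W\<^esub> e \<otimes>\<^bsub>W\<^esub> bo \<in> E" shows False
proof -
  have oi_F: "oi \<otimes> f \<otimes> oi \<in> F" if "f \<in> F" for f
  proof -
    have "f \<in> (\<lambda>w. fst w 0) ` E" using E_proj[OF n_pos] that by simp
    then obtain e where e: "f = fst e 0" "e \<in> E" by (rule imageE)
    have "fst (bo \<otimes>\<^bsub>W\<^esub> e \<otimes>\<^bsub>W\<^esub> bo) 0 = oi \<otimes> f \<otimes> oi"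
      using e n_pos E_snd[OF e(2)] by (simp add: W_mult_fst W_mult_snd bo_fst bo_snd)
    then show ?thesis using imageI[OF assms[OF e(2)], of "\<lambda>w. fst w 0"] E_proj[OF n_pos] by simp
  qed
  have inv_oi: "inv oi = oi" using oi(3) oi_carrier by (simp add: Y.inv_equality)
  have FY: "f \<in> F \<Longrightarrow> f \<in> carrier Y" for f using subgroup.mem_carrier[OF F(1)] .
  have conj: "\<forall>f\<in>F. x \<otimes> f \<otimes> inv x \<in> F" if "x \<in> generate Y (F \<union> {z, oi})" for x
    using that
  proof (induction rule: generate.induct)
    case one
    then show ?case using FY by simp
  next
    case (incl h)
    then show ?case
      using F_z(1) oi_F inv_oi subgroup.m_closed[OF F(1)] subgroup.m_inv_closed[OF F(1)] by auto
  next
    case (inv h)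
    then show ?case
      using F_z(2) oi_F inv_oi z(1) FY subgroup.m_closed[OF F(1)] subgroup.m_inv_closed[OF F(1)] by auto
  next
    case (eng h k)
    have hk: "h \<in> carrier Y" "k \<in> carrier Y" using eng.hyps gen by auto
    have "h \<otimes> k \<otimes> f \<otimes> inv (h \<otimes> k) = h \<otimes> (k \<otimes> f \<otimes> inv k) \<otimes> inv h" if "f \<in> F" for f
      using that hk FY by (simp add: Y.m_assoc Y.inv_mult_group)
    then show ?case using eng.IH by simp
  qed
  then have "F \<lhd> Y" using gen Y.normal_invI[OF F(1)] by blast
  then show False using F(3) by simp
qed

text \<open>A single exception would spread over \<open>E\<close>, as \<open>D\<close> is transitive
  on its non-identity elements and \<open>bo\<close> normalises \<open>D\<close>. All conjugates
  would then be elements of \<open>H\<close> of order dividing \<open>q^2\<close>, hence in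
  \<open>E\<close>.\<close>

lemma bo_E_H:
  assumes e: "e \<in> E - {\<one>\<^bsub>W\<^esub>}" shows "bo \<otimes>\<^bsub>W\<^esub> e \<otimes>\<^bsub>W\<^esub> bo \<notin> H"
proof
  assume H: "bo \<otimes>\<^bsub>W\<^esub> e \<otimes>\<^bsub>W\<^esub> bo \<in> H"
  have DH: "d \<in> H" if "d \<in> D" for d
    using that subgroup.one_closed[OF E(1)] D_W[OF that] H_iff by (metis W.l_one)
  have "bo \<otimes>\<^bsub>W\<^esub> e' \<otimes>\<^bsub>W\<^esub> bo \<in> H" if e': "e' \<in> E" for e'
  proof (cases "e' = \<one>\<^bsub>W\<^esub>")
    case True
    then show ?thesis using bo_W bo_bo subgroup.one_closed[OF H_sub] by simp
  next
    case False
    then obtain d where d: "d \<in> D" "inv\<^bsub>W\<^esub> d \<otimes>\<^bsub>W\<^esub> e \<otimes>\<^bsub>W\<^esub> d = e'" using E_trans[OF e, of e'] e' by blast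
    have "bo \<otimes>\<^bsub>W\<^esub> e' \<otimes>\<^bsub>W\<^esub> bo =
      (bo \<otimes>\<^bsub>W\<^esub> inv\<^bsub>W\<^esub> d \<otimes>\<^bsub>W\<^esub> bo) \<otimes>\<^bsub>W\<^esub> (bo \<otimes>\<^bsub>W\<^esub> e \<otimes>\<^bsub>W\<^esub> bo) \<otimes>\<^bsub>W\<^esub> (bo \<otimes>\<^bsub>W\<^esub> d \<otimes>\<^bsub>W\<^esub> bo)"
      using d(1) e D_W E_W bo_W by (simp add: W.m_assoc bo_cancel flip: d(2))
    moreover have "bo \<otimes>\<^bsub>W\<^esub> inv\<^bsub>W\<^esub> d \<otimes>\<^bsub>W\<^esub> bo \<in> H" "bo \<otimes>\<^bsub>W\<^esub> d \<otimes>\<^bsub>W\<^esub> bo \<in> H"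
      using DH bo_D d(1) subgroup.m_inv_closed[OF D_sub] by auto
    ultimately show ?thesis using H subgroup.m_closed[OF H_sub] by simp
  qed
  moreover have "(bo \<otimes>\<^bsub>W\<^esub> e' \<otimes>\<^bsub>W\<^esub> bo) [^]\<^bsub>W\<^esub> q\<^sup>2 = \<one>\<^bsub>W\<^esub>" if "e' \<in> E" for e'
    using that E_exponent bo_conj_pow E_W bo_W bo_bo by simp
  ultimately show False using H_torsion_E bo_not_normalises_E by blast
qed

section \<open>Separation of coordinates and generation\<close>

lemma card_E_ker:
  assumes i: "i < n" shows "q * card {w \<in> E. fst w i = \<one>} = q\<^sup>2"
proof -
  interpret EG: group "W\<lparr>carrier := E\<rparr>" using W.subgroup_imp_group[OF E(1)] .
  interpret FG: group "Y\<lparr>carrier := F\<rparr>" using Y.subgroup_imp_group[OF F(1)] .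
  interpret h: group_hom "W\<lparr>carrier := E\<rparr>" "Y\<lparr>carrier := F\<rparr>" "\<lambda>w. fst w i"
  proof (intro group_hom.intro group_hom_axioms.intro homI)
    show "fst w i \<in> carrier (Y\<lparr>carrier := F\<rparr>)" if "w \<in> carrier (W\<lparr>carrier := E\<rparr>)" for w
      using that E_proj[OF i] by auto
    show "fst (v \<otimes>\<^bsub>W\<lparr>carrier := E\<rparr>\<^esub> w) i = fst v i \<otimes>\<^bsub>Y\<lparr>carrier := F\<rparr>\<^esub> fst w i"
      if "v \<in> carrier (W\<lparr>carrier := E\<rparr>)" "w \<in> carrier (W\<lparr>carrier := E\<rparr>)" for v w
      using that i E_snd[of v] by (simp add: base_mult_fst)
  qed (rule EG.group_axioms FG.group_axioms)+
  let ?K = "kernel (W\<lparr>carrier := E\<rparr>) (Y\<lparr>carrier := F\<rparr>) (\<lambda>w. fst w i)"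
  have "card (carrier (W\<lparr>carrier := E\<rparr> Mod ?K)) = card F"
    using iso_same_card[OF h.FactGroup_iso] E_proj[OF i] by simp
  then have "card (rcosets\<^bsub>W\<lparr>carrier := E\<rparr>\<^esub> ?K) = q" using F(2) by (simp add: FactGroup_def)
  moreover have "card (rcosets\<^bsub>W\<lparr>carrier := E\<rparr>\<^esub> ?K) * card ?K = q\<^sup>2"
    using EG.lagrange[OF h.subgroup_kernel] E(3) by (simp add: order_def)
  moreover have "?K = {w \<in> E. fst w i = \<one>}" by (auto simp: kernel_def)
  ultimately show ?thesis by simp
qed

text \<open>Kernels of the same order that are distinct cannot be contained in one another; the
  common order comes from the first isomorphism theorem.\<close>

lemma E_separates:
  assumes ij: "i < n" "j < n" "i \<noteq> j" shows "\<exists>w\<in>E. fst w i = \<one> \<and> fst w j \<noteq> \<one>"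
proof (rule ccontr)
  assume "\<not> ?thesis"
  then have sub: "{w \<in> E. fst w i = \<one>} \<subseteq> {w \<in> E. fst w j = \<one>}" by blast
  have "finite E" using E(3) q by (intro card_ge_0_finite) simp
  moreover have "q * card {w \<in> E. fst w i = \<one>} = q * card {w \<in> E. fst w j = \<one>}"
    unfolding card_E_ker[OF ij(1)] card_E_ker[OF ij(2)] ..
  then have "card {w \<in> E. fst w i = \<one>} = card {w \<in> E. fst w j = \<one>}" using q by simp
  ultimately have "{w \<in> E. fst w i = \<one>} = {w \<in> E. fst w j = \<one>}"
    using card_subset_eq[OF _ sub] by simp
  then show False using E_ker[OF ij] by simp
qed

lemma base_pow_subset:
  assumes L: "subgroup L W" and HL: "E \<subseteq> L" "\<theta> \<in> L" "bo \<in> L"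
  shows "base_pow n T \<subseteq> L"
proof (rule base_pow_subset_subdirect[OF T L])
  show "\<exists>w\<in>L \<inter> base_pow n T. fst w j \<noteq> \<one>" if "j < n" for j
    using HL(3) bo_base bo_fst[OF that] oi(2) by (intro bexI[of _ bo]) auto
  show "\<exists>w\<in>L \<inter> base_pow n T. fst w i = \<one> \<and> fst w j \<noteq> \<one>"
    if ij: "i < n" "j < n" "i \<noteq> j" for i j
  proof -
    obtain w where "w \<in> E" "fst w i = \<one> \<and> fst w j \<noteq> \<one>" using E_separates[OF ij] ..
    then show ?thesis using HL(1) E_T by (intro bexI[of _ w]) auto
  qed
  fix j x assume j: "j < n" and x: "x \<in> carrier Y"
  let ?L = "L \<inter> base_pow n (carrier Y)"
  let ?P = "(\<lambda>w. fst w j) ` ?L"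
  have Ls: "subgroup ?L W"
    using W.subgroups_Inter_pair[OF L base_pow_subgroup[OF Y.subgroup_self]] .
  interpret h: group_hom "W\<lparr>carrier := ?L\<rparr>" Y "\<lambda>w. fst w j"
    using proj_hom[OF Ls _ j] by simp
  have P: "subgroup ?P Y" using h.img_is_subgroup by simp
  have "\<theta> [^]\<^bsub>W\<^esub> k \<in> L" for k :: nat
    using HL(2) subgroup.one_closed[OF L] subgroup.m_closed[OF L] by (induction k) simp_all
  \<comment> \<open>\<open>\<theta>\<close> itself is outside the base group; its
    \<open>n\<close>-th power is the element of \<open>L\<close> that supplies \<open>z\<close> in
    coordinate \<open>j\<close>.\<close>
  from this[of n] have "\<theta> [^]\<^bsub>W\<^esub> n \<in> ?L" using z(1) by (simp add: theta(3) base_pow_iff)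
  moreover have "fst (\<theta> [^]\<^bsub>W\<^esub> n) j = z" using j by (simp add: theta(3))
  ultimately have "z \<in> ?P" by (metis imageI)
  moreover have "bo \<in> ?L" using HL(3) oi_carrier by (simp add: bo_def base_pow_iff)
  then have "oi \<in> ?P" using bo_fst[OF j] by (metis imageI)
  moreover have "F \<subseteq> ?P" using E_proj[OF j] HL(1) E(2) by blast
  ultimately have "generate Y (F \<union> {z, oi}) \<subseteq> ?P" by (intro Y.generate_subgroup_incl[OF _ P]) auto
  then obtain w where "w \<in> ?L" "x = fst w j" using gen x by blast
  then show "\<exists>w\<in>L. snd w = 0 \<and> fst w j = x" by (intro bexI[of _ w]) (auto simp: base_pow_iff)
qed

theorem coset_graph:
  fixes G
  assumes G_def: "G = base_pow n T <#>\<^bsub>W\<^esub> D"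
  shows "graph_connected (cos_vertices W G H) (cos_adj W G H bo)"
    "cos_two_arc_transitive W G H bo"
    "graph_valency (cos_vertices W G H) (cos_adj W G H bo) (q\<^sup>2)"
proof -
  have BT: "subgroup (base_pow n T) W" using base_pow_subgroup[OF T_sub] .
  have G: "subgroup G W"
    unfolding G_def using W.set_mult_subgroupI[OF BT D_sub]
      normal.inv_op_closed2[OF base_pow_normal[OF T(1)] D_W] by blast
  have TG: "base_pow n T \<subseteq> G"
  proof
    fix w assume w: "w \<in> base_pow n T"
    then have "w = w \<otimes>\<^bsub>W\<^esub> \<one>\<^bsub>W\<^esub>" using subgroup.mem_carrier[OF BT w] by simp
    then show "w \<in> G" unfolding G_def set_mult_def using w subgroup.one_closed[OF D_sub] by blast
  qed
  have DG: "D \<subseteq> G"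
  proof
    fix d assume d: "d \<in> D"
    then have "d = \<one>\<^bsub>W\<^esub> \<otimes>\<^bsub>W\<^esub> d" using D_W by simp
    then show "d \<in> G" unfolding G_def set_mult_def using d subgroup.one_closed[OF BT] by blast
  qed
  interpret g: split_coset_graph W G E D H bo
  proof (rule split_coset_graph.intro[OF W.group_axioms split_coset_graph_axioms.intro])
    show "E \<subseteq> G" "bo \<in> G" using E_T TG bo_base by auto
  qed (fact G E(1) D_sub DG H_def E_norm E_trans bo_bo bo_D bo_E_H)+
  show "cos_two_arc_transitive W G H bo" by (rule g.two_arc_transitive)
  show "graph_valency (cos_vertices W G H) (cos_adj W G H bo) (q\<^sup>2)" using g.valency E(3) by simp
  let ?L = "generate W (insert bo H)"
  have L: "subgroup ?L W"
    using W.generate_is_subgroup[of "insert bo H"] bo_W g.H_carrier by blast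
  have HL: "H \<subseteq> ?L" "bo \<in> ?L" using generate.incl[of _ "insert bo H" W] by auto
  have "\<theta> \<in> D" using theta_pow_D[of 1] theta(1) by simp
  then have "base_pow n T \<subseteq> ?L" using base_pow_subset[OF L] g.EH g.DH HL by blast
  then have "G \<subseteq> ?L"
    unfolding G_def set_mult_def using subgroup.m_closed[OF L] g.DH HL by blast
  then show "graph_connected (cos_vertices W G H) (cos_adj W G H bo)" by (rule g.connected)
qed

end

text \<open>For odd \<open>q\<close> the divisibility means that \<open>q\<close> is 3 modulo 4, so
  \<open>(q - 1) / 2\<close> is odd; for even \<open>q\<close> the number \<open>q - 1\<close> is
  odd itself.\<close>

lemma odd_cofactor_of_two:
  fixes q :: nat
  assumes "odd q \<Longrightarrow> 4 dvd q + 1" "q > 0"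
  shows "odd ((q - 1) div gcd 2 (q - 1))" "gcd 2 (q - 1) = 1 \<or> gcd 2 (q - 1) = 2"
proof -
  have "odd ((q - 1) div gcd 2 (q - 1)) \<and> (gcd 2 (q - 1) = 1 \<or> gcd 2 (q - 1) = 2)"
  proof (cases "even q")
    case True
    then have "odd (q - 1)" using assms(2) by simp
    then have "coprime 2 (q - 1)" by simp
    then show ?thesis using \<open>odd (q - 1)\<close> by (simp add: coprime_iff_gcd_eq_1)
  next
    case False
    then have "2 dvd q - 1" by simp
    then have "gcd 2 (q - 1) = 2" by (simp add: gcd_nat.absorb1)
    moreover obtain l where l: "q + 1 = 4 * l" using assms(1)[OF False] by (rule dvdE)
    then have "(q - 1) div 2 = 2 * (l - 1) + 1" using assms(2) by presburger
    ultimately show ?thesis by simp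
  qed
  then show "odd ((q - 1) div gcd 2 (q - 1))" "gcd 2 (q - 1) = 1 \<or> gcd 2 (q - 1) = 2" by auto
qed

theorem theorem6p4:
  fixes p f q n s t r :: nat
    and X' :: "('a, 'x) monoid_scheme"
    and T R F :: "'a set" and b c oi :: 'a
    and E :: "((nat \<Rightarrow> 'a) \<times> nat) set"
  assumes C1: "Factorial_Ring.prime p" "f \<ge> 1" "q = p ^ f" "n = q + 1" "n = 2 ^ s * r ^ t" "n > 3"
      "Factorial_Ring.prime r" "odd r" "s \<ge> 2 \<or> even q"
    and C2: "almost_simple_with_socle X' T" "card (rcosets\<^bsub>X'\<^esub> T) \<le> 2"
      "subgroup R X'"
      "\<exists>K :: nat ring. field K \<and> finite (carrier K) \<and> card (carrier K) = q
                        \<and> X'\<lparr>carrier := R\<rparr> \<cong> AGL1 K"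
      "F \<lhd> X'\<lparr>carrier := R\<rparr>" "X'\<lparr>carrier := F\<rparr> \<cong> elem_ab p f"
      "b \<in> R" "c \<in> R" "b \<otimes>\<^bsub>X'\<^esub> c = c \<otimes>\<^bsub>X'\<^esub> b"
      "group.ord X' b = (q - 1) div gcd 2 (q - 1)" "group.ord X' c = gcd 2 (q - 1)"
      "generate X' {b} \<inter> generate X' {c} = {\<one>\<^bsub>X'\<^esub>}"
      "F \<inter> generate X' {b, c} = {\<one>\<^bsub>X'\<^esub>}"
      "F <#>\<^bsub>X'\<^esub> generate X' {b, c} = R"
    and W_def: "W = wreath X' n"
    and d0_def: "d0 = (\<lambda>i\<in>{0..<n}. if i = 1 then b else b \<otimes>\<^bsub>X'\<^esub> c)"
    and theta_def: "\<theta> = (d0, 0) \<otimes>\<^bsub>W\<^esub> wr_tau X' n"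
    and G_def: "G = base_pow n T <#>\<^bsub>W\<^esub> generate W {\<theta>}"
    and K_def: "K = base_pow n F <#>\<^bsub>W\<^esub> generate W {\<theta>}"
    and E_min: "minimal_normal (W\<lparr>carrier := K\<rparr>) E"
    and E1: "W\<lparr>carrier := E\<rparr> \<cong> elem_ab p (2 * f)"
    and E2: "\<forall>e1\<in>E - {\<one>\<^bsub>W\<^esub>}. \<forall>e2\<in>E - {\<one>\<^bsub>W\<^esub>}.
               \<exists>g\<in>generate W {\<theta>}. inv\<^bsub>W\<^esub> g \<otimes>\<^bsub>W\<^esub> e1 \<otimes>\<^bsub>W\<^esub> g = e2"
    and E3: "E \<subseteq> base_pow n (carrier X')"
      "\<forall>i<n. proj i ` E = F"
      "\<forall>i j. i < j \<and> j < n \<longrightarrow> proj_ker X' n i \<inter> E \<noteq> proj_ker X' n j \<inter> E"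
    and H_def: "H = E <#>\<^bsub>W\<^esub> generate W {\<theta>}"
    and o_inv: "oi \<in> T" "oi \<noteq> \<one>\<^bsub>X'\<^esub>" "oi \<otimes>\<^bsub>X'\<^esub> oi = \<one>\<^bsub>X'\<^esub>"
      "oi \<in> normalizer X' (generate X' {b, c})"
      "generate X' (F \<union> {b, c, oi}) = carrier X'"
    and bo_def: "bo = ((\<lambda>i\<in>{0..<n}. oi), 0)"
  shows "graph_connected (cos_vertices W G H) (cos_adj W G H bo)
       \<and> cos_two_arc_transitive W G H bo
       \<and> graph_valency (cos_vertices W G H) (cos_adj W G H bo) (q ^ 2)"
proof -
  have fin: "finite (carrier X')" and grp: "group X'"
    and simple: "simple_group (X'\<lparr>carrier := T\<rparr>)" and nonab: "\<not> comm_group (X'\<lparr>carrier := T\<rparr>)"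
    and soc: "socle X' = T"
    using C2(1) by (auto simp: almost_simple_with_socle_def)
  interpret Y: group X' by (rule grp)
  have n_pos: "n > 0" "n > 1" and q: "q \<ge> 3" using C1(4,6) by auto
  interpret cw: cyclic_wreath X' n using n_pos by unfold_locales

  \<comment> \<open>The socle\<close>
  have T: "T \<lhd> X'" using Y.socle_normal soc by simp
  have sT: "subgroup T X'" using T by (rule normal_imp_subgroup)
  have T_nonab: "\<exists>t\<in>T. \<exists>u\<in>T. t \<otimes>\<^bsub>X'\<^esub> u \<noteq> u \<otimes>\<^bsub>X'\<^esub> t"
    using nonab group.group_comm_groupI[OF Y.subgroup_imp_group[OF sT]] by auto
  note T_comm = Y.commutator_mem_index_two[OF T fin C2(2)]

  \<comment> \<open>The elementary abelian subgroup \<open>F\<close>\<close>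
  have sFR: "subgroup F (X'\<lparr>carrier := R\<rparr>)" using C2(5) by (rule normal_imp_subgroup)
  have sF: "subgroup F X'" using Y.incl_subgroup[OF C2(3) sFR] .
  have p: "p > 0" using C1(1) by (simp add: prime_gt_0_nat)
  note F_iso = iso_elem_ab[OF Y.subgroup_imp_group[OF sF] C2(6) p]
  have cardF: "card F = q" using F_iso(1) C1(3) by simp
  have F_not: "\<not> F \<lhd> X'"
  proof
    assume "F \<lhd> X'"
    moreover have "x \<otimes>\<^bsub>X'\<^esub> y = y \<otimes>\<^bsub>X'\<^esub> x" if "x \<in> F" "y \<in> F" for x y
      using comm_groupE(4)[OF F_iso(2)] that by simp
    ultimately have "F = {\<one>\<^bsub>X'\<^esub>}" using Y.almost_simple_abelian_normal_trivial[OF C2(1)] by blast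
    then show False using cardF q by simp
  qed

  \<comment> \<open>The complement generated by \<open>b\<close> and \<open>c\<close> is
    cyclic\<close>
  have bc: "b \<in> carrier X'" "c \<in> carrier X'" using C2(7,8) subgroup.mem_carrier[OF C2(3)] by auto
  define g where "g = gcd 2 (q - 1)"
  define m where "m = (q - 1) div g"
  have "4 dvd q + 1" if "odd q"
  proof -
    have "2 \<le> s" using C1(9) that by simp
    then have "(2::nat) ^ 2 dvd 2 ^ s" by (rule le_imp_power_dvd)
    then have "(2::nat) ^ 2 dvd 2 ^ s * r ^ t" by (rule dvd_mult2)
    then show ?thesis using C1(4,5) by simp
  qed
  then have gm: "g * m = q - 1" "odd m" "g = 1 \<or> g = 2"
    using odd_cofactor_of_two[of q] q by (auto simp: g_def m_def)
  have bm: "b [^]\<^bsub>X'\<^esub> m = \<one>\<^bsub>X'\<^esub>" using Y.pow_ord_eq_1[OF bc(1)] C2(10) by (simp add: m_def g_def)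
  have cg: "c [^]\<^bsub>X'\<^esub> g = \<one>\<^bsub>X'\<^esub>" using Y.pow_ord_eq_1[OF bc(2)] C2(11) by (simp add: g_def)
  have c2: "c \<otimes>\<^bsub>X'\<^esub> c = \<one>\<^bsub>X'\<^esub>" using cg gm(3) bc by (auto simp: numeral_2_eq_2)
  \<comment> \<open>The value of \<open>b^n c^(n-1)\<close> for \<open>n = q + 1\<close>, once the
    exponents are reduced by the orders of \<open>b\<close> and \<open>c\<close>.\<close>
  define z where "z = b [^]\<^bsub>X'\<^esub> (2::nat) \<otimes>\<^bsub>X'\<^esub> c"
  have zc: "z \<in> carrier X'" using bc by (simp add: z_def)
  note cyc = Y.odd_times_two_cyclic[OF bc C2(9) gm(2) bm c2 z_def]
  have zq: "z [^]\<^bsub>X'\<^esub> (q - 1) = \<one>\<^bsub>X'\<^esub>"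
    using Y.nat_pow_pow[OF zc, of m g] cyc(1) cg gm(1) by (simp add: mult.commute)
  obtain kb :: nat where kb: "z [^]\<^bsub>X'\<^esub> kb = b" using cyc(2) by blast

  let ?C = "generate X' {b, c}"
  have sC: "subgroup ?C X'" using Y.generate_is_subgroup[of "{b, c}"] bc by simp
  have bC: "b \<in> ?C" "c \<in> ?C" using generate.incl[of _ "{b, c}" X'] by auto
  have zC: "z \<in> ?C"
    using bC subgroup.m_closed[OF sC] by (simp add: z_def numeral_2_eq_2 bc)
  have z_pow_C: "z [^]\<^bsub>X'\<^esub> k \<in> ?C" for k :: nat
    using zC subgroup.one_closed[OF sC] subgroup.m_closed[OF sC] by (induction k) simp_all
  have gz: "generate X' {z} = {z [^]\<^bsub>X'\<^esub> (k::nat) | k. True}"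
    using Y.generate_pow_on_finite_carrier[OF fin zc] by simp
  have C_z: "\<exists>k::nat. x = z [^]\<^bsub>X'\<^esub> k" if "x \<in> ?C" for x
  proof -
    have "{b, c} \<subseteq> generate X' {z}" unfolding gz using kb cyc(1) by auto
    then have "?C \<subseteq> generate X' {z}"
      using Y.generate_subgroup_incl Y.generate_is_subgroup[of "{z}"] zc by simp
    then show ?thesis using that gz by blast
  qed

  \<comment> \<open>Action of the involution on the complement\<close>
  have oic: "oi \<in> carrier X'" using subgroup.mem_carrier[OF sT o_inv(1)] .
  have inv_oi: "inv\<^bsub>X'\<^esub> oi = oi" using oic o_inv(3) by (simp add: Y.inv_equality)
  have oi_cancel: "oi \<otimes>\<^bsub>X'\<^esub> (oi \<otimes>\<^bsub>X'\<^esub> x) = x" if "x \<in> carrier X'" for x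
    using that oic o_inv(3) by (simp flip: Y.m_assoc)
  have oi_C: "oi \<otimes>\<^bsub>X'\<^esub> x \<otimes>\<^bsub>X'\<^esub> oi \<in> ?C" if x: "x \<in> ?C" for x
  proof -
    have "oi <#\<^bsub>X'\<^esub> ?C #>\<^bsub>X'\<^esub> inv\<^bsub>X'\<^esub> oi = ?C"
      using o_inv(4) subgroup.subset[OF sC] by (simp add: normalizer_def stabilizer_def)
    moreover have "oi \<otimes>\<^bsub>X'\<^esub> x \<otimes>\<^bsub>X'\<^esub> oi \<in> oi <#\<^bsub>X'\<^esub> ?C #>\<^bsub>X'\<^esub> inv\<^bsub>X'\<^esub> oi"
      using x by (auto simp: l_coset_def r_coset_def inv_oi)
    ultimately show ?thesis by simp
  qed
  \<comment> \<open>The conjugate is a power of \<open>z\<close> with trivial square, so it is the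
    identity or \<open>c\<close>. In the first case \<open>c\<close> is itself the identity.\<close>
  have oi_c: "oi \<otimes>\<^bsub>X'\<^esub> c \<otimes>\<^bsub>X'\<^esub> oi = c"
  proof -
    obtain k :: nat where k: "oi \<otimes>\<^bsub>X'\<^esub> c \<otimes>\<^bsub>X'\<^esub> oi = z [^]\<^bsub>X'\<^esub> k" using C_z[OF oi_C[OF bC(2)]] by blast
    have "z [^]\<^bsub>X'\<^esub> k \<otimes>\<^bsub>X'\<^esub> z [^]\<^bsub>X'\<^esub> k = oi \<otimes>\<^bsub>X'\<^esub> (c \<otimes>\<^bsub>X'\<^esub> c) \<otimes>\<^bsub>X'\<^esub> oi"
      unfolding k[symmetric] using oic bc by (simp add: Y.m_assoc oi_cancel)
    then have "z [^]\<^bsub>X'\<^esub> k \<otimes>\<^bsub>X'\<^esub> z [^]\<^bsub>X'\<^esub> k = \<one>\<^bsub>X'\<^esub>" using c2 oic o_inv(3) by simp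
    then consider "z [^]\<^bsub>X'\<^esub> k = \<one>\<^bsub>X'\<^esub>" | "z [^]\<^bsub>X'\<^esub> k = c" using cyc(3) by blast
    then show ?thesis
    proof cases
      case 1
      have "c = oi \<otimes>\<^bsub>X'\<^esub> (oi \<otimes>\<^bsub>X'\<^esub> c \<otimes>\<^bsub>X'\<^esub> oi) \<otimes>\<^bsub>X'\<^esub> oi"
        using oic bc o_inv(3) by (simp add: Y.m_assoc oi_cancel)
      also have "\<dots> = \<one>\<^bsub>X'\<^esub>" unfolding k 1 using oic o_inv(3) by simp
      finally show ?thesis using k 1 by simp
    qed (use k in simp)
  qed
  \<comment> \<open>The conjugate of \<open>b\<close> is written as \<open>b\<close> times a power
    of \<open>z\<close>, so that the correction factor can be recognised as an entry of a power of
    \<open>\<theta>^n\<close>.\<close>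
  obtain k :: nat where k: "oi \<otimes>\<^bsub>X'\<^esub> b \<otimes>\<^bsub>X'\<^esub> oi = b \<otimes>\<^bsub>X'\<^esub> z [^]\<^bsub>X'\<^esub> k"
  proof -
    have "inv\<^bsub>X'\<^esub> b \<otimes>\<^bsub>X'\<^esub> (oi \<otimes>\<^bsub>X'\<^esub> b \<otimes>\<^bsub>X'\<^esub> oi) \<in> ?C"
      using oi_C bC(1) subgroup.m_closed[OF sC] subgroup.m_inv_closed[OF sC] by simp
    then obtain k :: nat where k: "inv\<^bsub>X'\<^esub> b \<otimes>\<^bsub>X'\<^esub> (oi \<otimes>\<^bsub>X'\<^esub> b \<otimes>\<^bsub>X'\<^esub> oi) = z [^]\<^bsub>X'\<^esub> k"
      using C_z by blast
    then have "b \<otimes>\<^bsub>X'\<^esub> z [^]\<^bsub>X'\<^esub> k = oi \<otimes>\<^bsub>X'\<^esub> b \<otimes>\<^bsub>X'\<^esub> oi" 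
      using bc oic by (simp flip: k)
    then show thesis by (rule that[OF sym])
  qed

  \<comment> \<open>The element \<open>\<theta>\<close>, its \<open>n\<close>-th power and its
    conjugate\<close>
  have theta: "\<theta> = (\<lambda>i\<in>{0..<n}. if i = 1 then b else b \<otimes>\<^bsub>X'\<^esub> c, 1)"
    unfolding theta_def W_def
    using bc n_pos by (intro cw.W_eqI)
      (auto simp: cw.W_mult_ext cw.W_mult_fst cw.W_mult_snd d0_def wr_tau_def)
  have thetaW: "\<theta> \<in> carrier cw.W" using bc n_pos by (auto simp: theta cw.W_carrier_iff)
  have theta_n: "\<theta> [^]\<^bsub>cw.W\<^esub> n = (\<lambda>i\<in>{0..<n}. z, 0)"
  proof -
    have n_eq: "n = m * g + 2" "n - 1 = g * m + 1" using gm(1) C1(4) q by (auto simp: mult.commute)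
    have "b [^]\<^bsub>X'\<^esub> n = b [^]\<^bsub>X'\<^esub> (2::nat)"
    proof -
      have "b [^]\<^bsub>X'\<^esub> (m * g) = \<one>\<^bsub>X'\<^esub>" using Y.nat_pow_pow[OF bc(1), of m g] bm by simp
      then show ?thesis
        unfolding n_eq(1) Y.nat_pow_mult[OF bc(1), of "m * g" 2, symmetric] using bc by simp
    qed
    moreover have "c [^]\<^bsub>X'\<^esub> (n - 1) = c"
    proof -
      have "c [^]\<^bsub>X'\<^esub> (g * m) = \<one>\<^bsub>X'\<^esub>" using Y.nat_pow_pow[OF bc(2), of g m] cg by simp
      then show ?thesis unfolding n_eq(2) using bc by simp
    qed
    ultimately show ?thesis
      using cw.twisted_cycle_pow[OF bc C2(9) n_pos(2) theta] by (simp add: z_def)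
  qed
  have bo_theta: "bo \<otimes>\<^bsub>cw.W\<^esub> \<theta> \<otimes>\<^bsub>cw.W\<^esub> bo \<in> generate cw.W {\<theta>}"
  proof -
    have zk: "z [^]\<^bsub>X'\<^esub> k \<in> carrier X'" using zc by simp
    have comm: "c \<otimes>\<^bsub>X'\<^esub> z [^]\<^bsub>X'\<^esub> k = z [^]\<^bsub>X'\<^esub> k \<otimes>\<^bsub>X'\<^esub> c"
      using Y.nat_pow_mult[OF zc] cyc(1) by (metis add.commute)
    have "oi \<otimes>\<^bsub>X'\<^esub> (b \<otimes>\<^bsub>X'\<^esub> c) \<otimes>\<^bsub>X'\<^esub> oi = (oi \<otimes>\<^bsub>X'\<^esub> b \<otimes>\<^bsub>X'\<^esub> oi) \<otimes>\<^bsub>X'\<^esub> (oi \<otimes>\<^bsub>X'\<^esub> c \<otimes>\<^bsub>X'\<^esub> oi)"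
      using oic bc by (simp add: Y.m_assoc oi_cancel)
    \<comment> \<open>As \<open>oi\<close> fixes \<open>c\<close>, the entries \<open>b\<close> and
      \<open>b c\<close> of \<open>\<theta>\<close> acquire the same factor \<open>z^k\<close>; the
      correction is therefore diagonal and equals \<open>\<theta>^(n k)\<close>.\<close>
    then have k': "oi \<otimes>\<^bsub>X'\<^esub> (b \<otimes>\<^bsub>X'\<^esub> c) \<otimes>\<^bsub>X'\<^esub> oi = b \<otimes>\<^bsub>X'\<^esub> c \<otimes>\<^bsub>X'\<^esub> z [^]\<^bsub>X'\<^esub> k"
      unfolding oi_c k using comm bc zk by (simp add: Y.m_assoc)
    have "bo \<otimes>\<^bsub>cw.W\<^esub> \<theta> \<otimes>\<^bsub>cw.W\<^esub> bo = \<theta> \<otimes>\<^bsub>cw.W\<^esub> (\<lambda>i\<in>{0..<n}. z [^]\<^bsub>X'\<^esub> k, 0)"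
      using k k' n_pos by (intro cw.W_eqI)
        (auto simp: cw.W_mult_ext cw.W_mult_fst cw.W_mult_snd theta bo_def)
    also have "(\<lambda>i\<in>{0..<n}. z [^]\<^bsub>X'\<^esub> k, 0) = \<theta> [^]\<^bsub>cw.W\<^esub> (n * k)"
      using cw.W.nat_pow_pow[OF thetaW, of n k] cw.diag_pow[OF zc, of k] by (simp add: theta_n)
    also have "\<theta> \<otimes>\<^bsub>cw.W\<^esub> \<theta> [^]\<^bsub>cw.W\<^esub> (n * k) = \<theta> [^]\<^bsub>cw.W\<^esub> (1 + n * k)"
      using thetaW cw.W.nat_pow_mult[OF thetaW, of 1 "n * k"] by simp
    finally show ?thesis

      unfolding cw.W.generate_pow_on_finite_carrier[OF cw.finite_W[OF fin] thetaW] by blast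
  qed

  \<comment> \<open>\<open>F\<close>, \<open>z\<close> and the involution in the almost simple
    group\<close>
  have R_conj: "x \<otimes>\<^bsub>X'\<^esub> h \<otimes>\<^bsub>X'\<^esub> inv\<^bsub>X'\<^esub> x \<in> F" "inv\<^bsub>X'\<^esub> x \<otimes>\<^bsub>X'\<^esub> h \<otimes>\<^bsub>X'\<^esub> x \<in> F"
    if "x \<in> R" "h \<in> F" for x h
    using normal.inv_op_closed2[OF C2(5), of x h] normal.inv_op_closed1[OF C2(5), of x h] that
      Y.m_inv_consistent[OF C2(3)] by simp_all
  have zR: "z \<in> R"
    using C2(7,8) subgroup.m_closed[OF C2(3)] bc by (simp add: z_def numeral_2_eq_2)
  have z_F: "z [^]\<^bsub>X'\<^esub> k = \<one>\<^bsub>X'\<^esub>" if "z [^]\<^bsub>X'\<^esub> k \<in> F" for k :: nat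
    using that z_pow_C[of k] C2(13) by blast
  have gen: "generate X' (F \<union> {z, oi}) = carrier X'"
  proof
    have sub: "F \<union> {z, oi} \<subseteq> carrier X'" using subgroup.subset[OF sF] zc oic by auto
    have sg: "subgroup (generate X' (F \<union> {z, oi})) X'" using Y.generate_is_subgroup[OF sub] .
    show "generate X' (F \<union> {z, oi}) \<subseteq> carrier X'" using subgroup.subset[OF sg] .
    have inc: "F \<union> {z, oi} \<subseteq> generate X' (F \<union> {z, oi})"
      using generate.incl[of _ "F \<union> {z, oi}" X'] by (rule subsetI)
    have "z [^]\<^bsub>X'\<^esub> l \<in> generate X' (F \<union> {z, oi})" for l :: nat
      using inc subgroup.one_closed[OF sg] subgroup.m_closed[OF sg] by (induction l) simp_all
    \<comment> \<open>Both old generators are powers of \<open>z\<close>: \<open>b\<close> with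
      exponent \<open>kb\<close> and \<open>c\<close> with exponent \<open>m\<close>.\<close>
    from this[of kb] this[of m] have "F \<union> {b, c, oi} \<subseteq> generate X' (F \<union> {z, oi})"
      using inc kb cyc(1) by auto
    then show "carrier X' \<subseteq> generate X' (F \<union> {z, oi})"
      unfolding o_inv(5)[symmetric] by (rule Y.generate_subgroup_incl[OF _ sg])
  qed

  \<comment> \<open>The subgroup \<open>E\<close> of the wreath product\<close>
  let ?D = "generate cw.W {\<theta>}"
  have sD: "subgroup ?D cw.W" using cw.W.generate_is_subgroup thetaW by simp
  have sB: "subgroup (base_pow n F) cw.W" using cw.base_pow_subgroup[OF sF] .
  have DK: "?D \<subseteq> K"
  proof
    fix d assume d: "d \<in> ?D"
    then have "d = \<one>\<^bsub>cw.W\<^esub> \<otimes>\<^bsub>cw.W\<^esub> d" using subgroup.mem_carrier[OF sD] by simp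
    then show "d \<in> K" unfolding K_def W_def set_mult_def using d subgroup.one_closed[OF sB] by blast
  qed
  have nE: "E \<lhd> cw.W\<lparr>carrier := K\<rparr>" using E_min by (simp add: minimal_normal_def W_def)
  have "K \<subseteq> carrier cw.W"
    unfolding K_def W_def using cw.W.setmult_subset_G[OF subgroup.subset[OF sB] subgroup.subset[OF sD]] .
  \<comment> \<open>Normality of \<open>E\<close> in the structure on \<open>K\<close> already
    contains that this structure is a group.\<close>
  then have sK: "subgroup K cw.W"
    using cw.W.group_incl_imp_subgroup[OF _ normal.axioms(2)[OF nE]] by simp
  have sE: "subgroup E cw.W"
    using cw.W.incl_subgroup[OF sK normal_imp_subgroup[OF nE]] .
  have cardE: "card E = q\<^sup>2"
    using iso_elem_ab(1)[OF cw.W.subgroup_imp_group[OF sE] E1[unfolded W_def] p] C1(3)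
    by (simp add: power_mult[symmetric] mult.commute)
  have E_norm: "inv\<^bsub>cw.W\<^esub> d \<otimes>\<^bsub>cw.W\<^esub> e \<otimes>\<^bsub>cw.W\<^esub> d \<in> E" if "d \<in> ?D" "e \<in> E" for d e
  proof -
    have "d \<in> K" using that(1) DK by blast
    then show ?thesis
      using normal.inv_op_closed1[OF nE, of d e] that(2) cw.W.m_inv_consistent[OF sK, of d] by simp
  qed
  have ker: "proj_ker X' n i \<inter> E = {w \<in> E. fst w i = \<one>\<^bsub>X'\<^esub>}" for i
    using E3(1) by (auto simp: proj_ker_def proj_def)

  have setting: "coset_graph_setting X' n T F z oi E \<theta> q"
  proof (rule coset_graph_setting.intro[OF cw.cyclic_wreath_axioms coset_graph_setting_axioms.intro])
    show "(\<lambda>w. fst w i) ` E = F" if "i < n" for i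
      using E3(2) that by (simp add: proj_def[abs_def])
    \<comment> \<open>The hypothesis speaks of \<open>i < j\<close> only; the other order follows by
      symmetry.\<close>
    show "{w \<in> E. fst w i = \<one>\<^bsub>X'\<^esub>} \<noteq> {w \<in> E. fst w j = \<one>\<^bsub>X'\<^esub>}" if "i < n" "j < n" "i \<noteq> j" for i j
      using E3(3)[rule_format, of i j, unfolded ker] E3(3)[rule_format, of j i, unfolded ker] that
      by (cases "i < j") auto
    show "\<exists>d\<in>?D. inv\<^bsub>cw.W\<^esub> d \<otimes>\<^bsub>cw.W\<^esub> e \<otimes>\<^bsub>cw.W\<^esub> d = e'"
      if "e \<in> E - {\<one>\<^bsub>cw.W\<^esub>}" "e' \<in> E - {\<one>\<^bsub>cw.W\<^esub>}" for e e'
      using E2[unfolded W_def, rule_format, OF that] .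
    show "snd \<theta> = 1" by (simp add: theta)
  qed (fact fin C1(4) q T simple T_nonab T_comm sF cardF F_not R_conj[OF zR] z_F zc zq thetaW theta_n
      o_inv(1-3) gen bo_theta[unfolded bo_def] sE E3(1) cardE E_norm)+
  interpret S: coset_graph_setting X' n T F z oi E \<theta> q by (rule setting)
  show ?thesis
    using S.coset_graph[OF G_def[unfolded W_def]] unfolding W_def H_def S.H_def bo_def S.bo_def by simp
qed

end
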